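(* Let $\mathbf r(t)$ be a non-planar rational parametric space curve defined on an interval $I$ and let $t_0\in I$ be a parameter that is not the right endpoint of $I$. Then there exists $t_1>t_0$, $t_1\in I$, such that the segment $\mathbf r(t)$, $t\in[t_0,t_1]$, is a quasi-cubic Bézier segment.
   Context: Setting: $\mathbf r(t)=(x(t),y(t),z(t))$ with $x,y,z$ rational functions with real coefficients whose denominators do not vanish on the parameter interval, properly parametrized, and not contained in a plane (curvature $\kappa$ and torsion $\tau$ not identically zero). Here $\kappa=\|\mathbf r'\times\mathbf r''\|/\|\mathbf r'\|^3$ and $\tau$ vanishes exactly where $\det(\mathbf r',\mathbf r'',\mathbf r''')=0$. Unit tangent $\boldsymbol\alpha=\mathbf r'/\|\mathbf r'\|$, unit binormal $\boldsymbol\gamma=\mathbf r'\times\mathbf r''/\|\mathbf r'\times\mathbf r''\|$; at any parameter $s$ one uses the one-sided limits $\boldsymbol\alpha^{\pm}(s)=\lim_{t\to s^\pm}\boldsymbol\alpha(t)$, $\boldsymbol\gamma^{\pm}(s)=\lim_{t\to s^\pm}\boldsymbol\gamma(t)$ (which exist for rational curves); tangent lines $T^{\pm}(s)=\{\mathbf r(s)+\lambda\boldsymbol\alpha^{\pm}(s)\}$, osculating planes $O^{\pm}(s)=\{X:(X-\mathbf r(s))\cdot\boldsymbol\gamma^{\pm}(s)=0\}$ (at ordinary points the $\pm$ versions coincide and are written $O(s)$, $T(s)$). A point is singular if it corresponds to more than one parameter counted with multiplicity. Associated tetrahedron of the segment $[t_0,t_1]$: $\mathbf r_0=\mathbf r(t_0)$,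 $\mathbf r_3=\mathbf r(t_1)$, $L=O^+(t_0)\cap O^-(t_1)$, $\mathbf r_1=T^+(t_0)\cap L$, $\mathbf r_2=T^-(t_1)\cap L$; the tetrahedron $\mathbf r_0\mathbf r_1\mathbf r_2\mathbf r_3$ (requires these intersections to exist and $\mathbf r_1\neq\mathbf r_2$). For $t_0\le a<b\le t_1$ the associated tetrahedron of $[a,b]$ is defined the same way. Parallel point: for a segment lying on one side of a plane $Q$ with both endpoints on $Q$, a point $\mathbf r(t)$, $t$ interior, with $\mathbf r'(t)$ parallel to $Q$. Quasi-cubic Bézier segment: a segment $\mathbf r(t)$, $t\in[t_0,t_1]$, whose associated tetrahedron $\mathbf r_0\mathbf r_1\mathbf r_2\mathbf r_3$ is non-degenerate and which has the following eight properties: (Q1) the one-sided tangent directions at $t_0$ and $t_1$ are parallel to $\mathbf r_0\mathbf r_1$ and $\mathbf r_2\mathbf r_3$; (Q2) the planes $\mathbf r_0\mathbf r_1\mathbf r_2$ and $\mathbf r_1\mathbf r_2\mathbf r_3$ are $O^+(t_0)$ and $O^-(t_1)$; (Q3) $\mathbf r([t_0,t_1])$ lies in the tetrahedron; (Q4) the segment has no singular points and $\kappa(t)\ne0$, $\tau(t)\ne0$ for $t\in(t_0,t_1)$; (Q5) for all $t_0\le a<b\le t_1$ the associated tetrahedron of $[a,b]$ lies in $\mathbf r_0\mathbf r_1\mathbf r_2\mathbf r_3$; (Q6) for $t^\star\in(t_0,t_1)$, $O(t^\star)$ meets the lines $\mathbf r_0\mathbf r_1,\mathbf r_1\mathbf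 r_2,\mathbf r_2\mathbf r_3$ at points $\mathbf r_{01},\mathbf r_{12},\mathbf r_{23}$ and $\|\mathbf r_0\mathbf r_{01}\|,\|\mathbf r_1\mathbf r_{12}\|,\|\mathbf r_2\mathbf r_{23}\|$ are strictly monotone in $t^\star$; (Q7) with $\mathbf r_{03}$ the intersection of the plane $\mathbf r_1\mathbf r_2\mathbf r(t^\star)$ with line $\mathbf r_0\mathbf r_3$ and $\mathbf r_{12}'$ the intersection of the plane $\mathbf r_0\mathbf r_3\mathbf r(t^\star)$ with line $\mathbf r_1\mathbf r_2$, $\|\mathbf r_0\mathbf r_{03}\|$ and $\|\mathbf r_1\mathbf r_{12}'\|$ are strictly monotone in $t^\star\in(t_0,t_1)$; (Q8) there is exactly one parallel point associated to the plane $\mathbf r_0\mathbf r_2\mathbf r_3$ and exactly one associated to the plane $\mathbf r_0\mathbf r_1\mathbf r_3$, and they are the points of the segment at maximal distance from these planes. *)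

theory Defs
  imports "HOL-Analysis.Analysis" "HOL-Computational_Algebra.Polynomial"
begin

definition rat_curve :: "real poly ^ 3 \<Rightarrow> real poly ^ 3 \<Rightarrow> real \<Rightarrow> real ^ 3" where
  "rat_curve p q t = (\<chi> i. poly (p $ i) t / poly (q $ i) t)"

definition rat_curve_c :: "real poly ^ 3 \<Rightarrow> real poly ^ 3 \<Rightarrow> complex \<Rightarrow> 3 \<Rightarrow> complex" where
  "rat_curve_c p q z i = poly (map_poly complex_of_real (p $ i)) z / poly (map_poly complex_of_real (q $ i)) z"

definition defined_at_c :: "real poly ^ 3 \<Rightarrow> complex \<Rightarrow> bool" where
  "defined_at_c q z \<longleftrightarrow> (\<forall>i. poly (map_poly complex_of_real (q $ i)) z \<noteq> 0)"

definition proper_param :: "real poly ^ 3 \<Rightarrow> real poly ^ 3 \<Rightarrow> bool" where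
  "proper_param p q \<longleftrightarrow>
     finite {z. defined_at_c q z \<and>
                (\<exists>w. w \<noteq> z \<and> defined_at_c q w \<and> rat_curve_c p q w = rat_curve_c p q z)}"

definition non_planar :: "(real \<Rightarrow> real ^ 3) \<Rightarrow> real set \<Rightarrow> bool" where
  "non_planar r I \<longleftrightarrow> \<not> (\<exists>n c. n \<noteq> 0 \<and> (\<forall>t\<in>I. n \<bullet> r t = c))"

definition d1 :: "(real \<Rightarrow> real ^ 3) \<Rightarrow> real \<Rightarrow> real ^ 3" where
  "d1 r t = vector_derivative r (at t)"

definition d2 :: "(real \<Rightarrow> real ^ 3) \<Rightarrow> real \<Rightarrow> real ^ 3" where
  "d2 r t = vector_derivative (d1 r) (at t)"

definition d3 :: "(real \<Rightarrow> real ^ 3) \<Rightarrow> real \<Rightarrow> real ^ 3" where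
  "d3 r t = vector_derivative (d2 r) (at t)"

definition curvature :: "(real \<Rightarrow> real ^ 3) \<Rightarrow> real \<Rightarrow> real" where
  "curvature r t = norm (cross3 (d1 r t) (d2 r t)) / norm (d1 r t) ^ 3"

definition torsion :: "(real \<Rightarrow> real ^ 3) \<Rightarrow> real \<Rightarrow> real" where
  "torsion r t = (cross3 (d1 r t) (d2 r t) \<bullet> d3 r t) / norm (cross3 (d1 r t) (d2 r t)) ^ 2"

definition unit_tangent :: "(real \<Rightarrow> real ^ 3) \<Rightarrow> real \<Rightarrow> real ^ 3" where
  "unit_tangent r t = (1 / norm (d1 r t)) *\<^sub>R d1 r t"

definition unit_binormal :: "(real \<Rightarrow> real ^ 3) \<Rightarrow> real \<Rightarrow> real ^ 3" where
  "unit_binormal r t = (1 / norm (cross3 (d1 r t) (d2 r t))) *\<^sub>R cross3 (d1 r t) (d2 r t)"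

definition tangent_plus :: "(real \<Rightarrow> real ^ 3) \<Rightarrow> real \<Rightarrow> real ^ 3" where
  "tangent_plus r s = Lim (at_right s) (unit_tangent r)"

definition tangent_minus :: "(real \<Rightarrow> real ^ 3) \<Rightarrow> real \<Rightarrow> real ^ 3" where
  "tangent_minus r s = Lim (at_left s) (unit_tangent r)"

definition binormal_plus :: "(real \<Rightarrow> real ^ 3) \<Rightarrow> real \<Rightarrow> real ^ 3" where
  "binormal_plus r s = Lim (at_right s) (unit_binormal r)"

definition binormal_minus :: "(real \<Rightarrow> real ^ 3) \<Rightarrow> real \<Rightarrow> real ^ 3" where
  "binormal_minus r s = Lim (at_left s) (unit_binormal r)"

definition tline_plus :: "(real \<Rightarrow> real ^ 3) \<Rightarrow> real \<Rightarrow> (real ^ 3) set" where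
  "tline_plus r s = {r s + c *\<^sub>R tangent_plus r s | c. True}"

definition tline_minus :: "(real \<Rightarrow> real ^ 3) \<Rightarrow> real \<Rightarrow> (real ^ 3) set" where
  "tline_minus r s = {r s + c *\<^sub>R tangent_minus r s | c. True}"

definition osc_plus :: "(real \<Rightarrow> real ^ 3) \<Rightarrow> real \<Rightarrow> (real ^ 3) set" where
  "osc_plus r s = {X. (X - r s) \<bullet> binormal_plus r s = 0}"

definition osc_minus :: "(real \<Rightarrow> real ^ 3) \<Rightarrow> real \<Rightarrow> (real ^ 3) set" where
  "osc_minus r s = {X. (X - r s) \<bullet> binormal_minus r s = 0}"

definition osc :: "(real \<Rightarrow> real ^ 3) \<Rightarrow> real \<Rightarrow> (real ^ 3) set" where
  "osc r s = {X. (X - r s) \<bullet> unit_binormal r s = 0}"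

text \<open>Singular point: r(t) corresponds to more than one parameter of I counted with
 multiplicity (another parameter, or t itself with multiplicity > 1, i.e. r'(t) = 0).\<close>
definition singular_param :: "(real \<Rightarrow> real ^ 3) \<Rightarrow> real set \<Rightarrow> real \<Rightarrow> bool" where
  "singular_param r I t \<longleftrightarrow> (\<exists>s\<in>I. s \<noteq> t \<and> r s = r t) \<or> d1 r t = 0"

definition assoc_tet :: "(real \<Rightarrow> real ^ 3) \<Rightarrow> real \<Rightarrow> real \<Rightarrow>
    real ^ 3 \<Rightarrow> real ^ 3 \<Rightarrow> real ^ 3 \<Rightarrow> real ^ 3 \<Rightarrow> bool" where
  "assoc_tet r a b r0 r1 r2 r3 \<longleftrightarrow>
     r0 = r a \<and> r3 = r b \<and>
     tline_plus r a \<inter> (osc_plus r a \<inter> osc_minus r b) = {r1} \<and>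
     tline_minus r b \<inter> (osc_plus r a \<inter> osc_minus r b) = {r2} \<and>
     r1 \<noteq> r2"

definition parallel_vec :: "real ^ 3 \<Rightarrow> real ^ 3 \<Rightarrow> bool" where
  "parallel_vec u v \<longleftrightarrow> u \<noteq> 0 \<and> v \<noteq> 0 \<and> cross3 u v = 0"

definition strictly_monotone_on :: "real set \<Rightarrow> (real \<Rightarrow> real) \<Rightarrow> bool" where
  "strictly_monotone_on S f \<longleftrightarrow>
     (\<forall>x\<in>S. \<forall>y\<in>S. x < y \<longrightarrow> f x < f y) \<or> (\<forall>x\<in>S. \<forall>y\<in>S. x < y \<longrightarrow> f x > f y)"

definition parallel_to_plane :: "real ^ 3 \<Rightarrow> (real ^ 3) set \<Rightarrow> bool" where
  "parallel_to_plane v Q \<longleftrightarrow> (\<exists>a\<in>Q. a + v \<in> Q)"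

text \<open>Parallel points of the segment [t0,t1] w.r.t. a plane Q (the segment being on
 one side of Q with both endpoints on Q).\<close>
definition parallel_points :: "(real \<Rightarrow> real ^ 3) \<Rightarrow> real \<Rightarrow> real \<Rightarrow> (real ^ 3) set \<Rightarrow> (real ^ 3) set" where
  "parallel_points r t0 t1 Q = {r t | t. t0 < t \<and> t < t1 \<and> parallel_to_plane (d1 r t) Q}"

definition farthest_points :: "(real \<Rightarrow> real ^ 3) \<Rightarrow> real \<Rightarrow> real \<Rightarrow> (real ^ 3) set \<Rightarrow> (real ^ 3) set" where
  "farthest_points r t0 t1 Q =
     {x \<in> r ` {t0..t1}. \<forall>y \<in> r ` {t0..t1}. infdist y Q \<le> infdist x Q}"

definition quasi_cubic :: "(real \<Rightarrow> real ^ 3) \<Rightarrow> real set \<Rightarrow> real \<Rightarrow> real \<Rightarrow> bool" where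
  "quasi_cubic r I t0 t1 \<longleftrightarrow> t0 < t1 \<and>
   (\<exists>r0 r1 r2 r3. assoc_tet r t0 t1 r0 r1 r2 r3 \<and> \<not> coplanar {r0, r1, r2, r3} \<and>
     \<comment> \<open>Q1\<close>
     parallel_vec (tangent_plus r t0) (r1 - r0) \<and> parallel_vec (tangent_minus r t1) (r3 - r2) \<and>
     \<comment> \<open>Q2\<close>
     affine hull {r0, r1, r2} = osc_plus r t0 \<and> affine hull {r1, r2, r3} = osc_minus r t1 \<and>
     \<comment> \<open>Q3\<close>
     r ` {t0..t1} \<subseteq> convex hull {r0, r1, r2, r3} \<and>
     \<comment> \<open>Q4\<close>
     (\<forall>t. t0 < t \<and> t < t1 \<longrightarrow>
        \<not> singular_param r I t \<and> curvature r t \<noteq> 0 \<and> torsion r t \<noteq> 0) \<and>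
     \<comment> \<open>Q5\<close>
     (\<forall>a b. t0 \<le> a \<and> a < b \<and> b \<le> t1 \<longrightarrow>
        (\<exists>s0 s1 s2 s3. assoc_tet r a b s0 s1 s2 s3 \<and>
           convex hull {s0, s1, s2, s3} \<subseteq> convex hull {r0, r1, r2, r3})) \<and>
     \<comment> \<open>Q6\<close>
     (\<exists>p01 p12 p23.
        (\<forall>t. t0 < t \<and> t < t1 \<longrightarrow>
           osc r t \<inter> affine hull {r0, r1} = {p01 t} \<and>
           osc r t \<inter> affine hull {r1, r2} = {p12 t} \<and>
           osc r t \<inter> affine hull {r2, r3} = {p23 t}) \<and>
        strictly_monotone_on {t0<..<t1} (\<lambda>t. dist r0 (p01 t)) \<and>
        strictly_monotone_on {t0<..<t1} (\<lambda>t. dist r1 (p12 t)) \<and>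
        strictly_monotone_on {t0<..<t1} (\<lambda>t. dist r2 (p23 t))) \<and>
     \<comment> \<open>Q7\<close>
     (\<exists>p03 q12.
        (\<forall>t. t0 < t \<and> t < t1 \<longrightarrow>
           \<not> collinear {r1, r2, r t} \<and> \<not> collinear {r0, r3, r t} \<and>
           affine hull {r1, r2, r t} \<inter> affine hull {r0, r3} = {p03 t} \<and>
           affine hull {r0, r3, r t} \<inter> affine hull {r1, r2} = {q12 t}) \<and>
        strictly_monotone_on {t0<..<t1} (\<lambda>t. dist r0 (p03 t)) \<and>
        strictly_monotone_on {t0<..<t1} (\<lambda>t. dist r1 (q12 t))) \<and>
     \<comment> \<open>Q8\<close>
     (\<exists>p. parallel_points r t0 t1 (affine hull {r0, r2, r3}) = {p} \<and>
          farthest_points r t0 t1 (affine hull {r0, r2, r3}) = {p}) \<and>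
     (\<exists>p. parallel_points r t0 t1 (affine hull {r0, r1, r3}) = {p} \<and>
          farthest_points r t0 t1 (affine hull {r0, r1, r3}) = {p}))"

end

theory Submission
  imports Defs
begin

text \<open>
  Suppose \<open>r' = \<rho> T\<close>, \<open>T' = \<sigma> N\<close>, \<open>N' = \<omega> B\<close> with positive rates and a constant vector \<open>B\<close>. Integrating
  one vector at a time shows that for \<open>s < t\<close> the determinants of \<open>T s, N s, r t - r s\<close>, of
  \<open>T s, r t - r s, T t\<close>, of \<open>r t - r s, T t, N t\<close> and their relatives are positive. By Cramer's rule and
  the Pluecker relation every inequality behind the eight properties reduces to these. For instance, the
  ratio in which the osculating plane at \<open>t\<close> divides an edge \<open>u v\<close> is monotone because the determinant of
  \<open>T t, u - r t, v - r t\<close> has constant sign. Tetrahedra of subsegments are compared by moving one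
  endpoint at a time, and reversing the curve exchanges the roles of the endpoints.

  A non-planar rational curve has, at any parameter, coordinates \<open>x\<close>, \<open>f\<close>, \<open>g\<close> vanishing to strictly
  increasing orders. The quotients \<open>y = f'/x'\<close>, \<open>p = g'/x'\<close>, \<open>w = p'/y'\<close> yield such a frame to the right of
  this parameter. Properness only excludes double points.\<close>

section \<open>Calculus on an interval\<close>

lemma DERIV_pos_imp_pos:
  fixes h h' :: "real \<Rightarrow> real"
  assumes "continuous_on {a..b} h" "a \<le> s" "0 \<le> h s"
    and "\<And>z. s < z \<Longrightarrow> z < b \<Longrightarrow> (h has_real_derivative h' z) (at z)"
    and "\<And>z. s < z \<Longrightarrow> z < b \<Longrightarrow> 0 < h' z"
    and "s < t" "t \<le> b"
  shows "0 < h t"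
proof -
  have "h s < h t"
  proof (rule DERIV_pos_imp_increasing_open[OF \<open>s < t\<close>])
    show "\<exists>y. (h has_real_derivative y) (at z) \<and> 0 < y" if "s < z" "z < t" for z
      using assms(4,5)[of z] \<open>t \<le> b\<close> that by auto
  qed (use assms in \<open>auto intro: continuous_on_subset\<close>)
  with assms(3) show ?thesis by simp
qed

lemma DERIV_quotient_less:
  fixes u v u' v' c :: "real \<Rightarrow> real"
  assumes "continuous_on {a..b} u" "continuous_on {a..b} v" "a \<le> s" "s < t" "t \<le> b"
    and nonzero: "\<And>z. s \<le> z \<Longrightarrow> z \<le> t \<Longrightarrow> v z \<noteq> 0"
    and u': "\<And>z. s < z \<Longrightarrow> z < t \<Longrightarrow> (u has_real_derivative c z * u' z) (at z)"
    and v': "\<And>z. s < z \<Longrightarrow> z < t \<Longrightarrow> (v has_real_derivative c z * v' z) (at z)"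
    and wronskian: "\<And>z. s < z \<Longrightarrow> z < t \<Longrightarrow> 0 < c z * (u' z * v z - u z * v' z)"
  shows "u s / v s < u t / v t"
proof (rule DERIV_pos_imp_increasing_open[OF \<open>s < t\<close>, where f = "\<lambda>z. u z / v z"])
  fix z assume z: "s < z" "z < t"
  have "((\<lambda>z. u z / v z) has_real_derivative c z * (u' z * v z - u z * v' z) / (v z * v z)) (at z)"
    using DERIV_divide[OF u'[OF z] v'[OF z]] nonzero z by (simp add: algebra_simps)
  moreover have "0 < c z * (u' z * v z - u z * v' z) / (v z * v z)"
    using wronskian[OF z] nonzero[of z] z by (intro divide_pos_pos) (auto simp: zero_less_mult_iff)
  ultimately show "\<exists>y. ((\<lambda>z. u z / v z) has_real_derivative y) (at z) \<and> 0 < y" by blast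
next
  show "continuous_on {s..t} (\<lambda>z. u z / v z)"
    using assms(3-5) nonzero
    by (intro continuous_on_divide assms(1,2)[THEN continuous_on_subset]) auto
qed

lemma Rolle_unique_max:
  fixes h h' :: "real \<Rightarrow> real"
  assumes "a < b" "continuous_on {a..b} h" "h a = h b"
    and deriv: "\<And>t. a < t \<Longrightarrow> t < b \<Longrightarrow> (h has_real_derivative h' t) (at t)"
    and sign_change: "\<And>s t. a < s \<Longrightarrow> s < t \<Longrightarrow> t < b \<Longrightarrow> h' s \<le> 0 \<Longrightarrow> h' t < 0"
  obtains c where "a < c" "c < b" "\<And>t. a < t \<Longrightarrow> t < b \<Longrightarrow> h' t = 0 \<longleftrightarrow> t = c"
    "\<And>t. a \<le> t \<Longrightarrow> t \<le> b \<Longrightarrow> t \<noteq> c \<Longrightarrow> h t < h c" "\<And>t. a < t \<Longrightarrow> t < b \<Longrightarrow> h a < h t"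
proof -
  have "h differentiable (at t)" if "a < t" "t < b" for t
    using deriv[OF that] real_differentiable_def by blast
  then obtain c where critical: "a < c" "c < b" "(h has_real_derivative 0) (at c)"
    using Rolle[OF assms(1,3,2)] by auto
  have zero: "h' c = 0" using DERIV_unique[OF deriv[OF critical(1,2)] critical(3)] .
  have left: "0 < h' t" if "a < t" "t < c" for t using sign_change[of t c] that critical zero by fastforce
  have right: "h' t < 0" if "c < t" "t < b" for t using sign_change[of c t] that critical zero by auto
  have increasing: "h s < h t" if "a \<le> s" "s < t" "t \<le> c" for s t
  proof (rule DERIV_pos_imp_increasing_open[OF that(2)])
    show "\<exists>y. (h has_real_derivative y) (at z) \<and> 0 < y" if "s < z" "z < t" for z
      using that \<open>a \<le> s\<close> \<open>t \<le> c\<close> critical(2) by (intro exI[of _ "h' z"] conjI deriv left) auto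
  qed (use that critical in \<open>auto intro: continuous_on_subset[OF assms(2)]\<close>)
  have decreasing: "h t < h s" if "c \<le> s" "s < t" "t \<le> b" for s t
  proof (rule DERIV_neg_imp_decreasing_open[OF that(2)])
    show "\<exists>y. (h has_real_derivative y) (at z) \<and> y < 0" if "s < z" "z < t" for z
      using that \<open>c \<le> s\<close> \<open>t \<le> b\<close> critical(1) by (intro exI[of _ "h' z"] conjI deriv right) auto
  qed (use that critical in \<open>auto intro: continuous_on_subset[OF assms(2)]\<close>)
  show ?thesis
  proof
    show "h' t = 0 \<longleftrightarrow> t = c" if "a < t" "t < b" for t
      using left[of t] right[of t] zero that by force
    show "h t < h c" if "a \<le> t" "t \<le> b" "t \<noteq> c" for t
      using increasing[of t c] decreasing[of c t] that by force
    show "h a < h t" if "a < t" "t < b" for t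
      using increasing[of a t] decreasing[of t b] that assms(3) by (cases "t \<le> c") auto
  qed (use critical in auto)
qed

lemma vector_derivative_eq_on_interval:
  assumes "(k has_vector_derivative k') (at t)" "a < t" "t < b" "\<And>s. a < s \<Longrightarrow> s < b \<Longrightarrow> h s = k s"
  shows "vector_derivative h (at t) = k'"
proof (rule vector_derivative_at)
  show "(h has_vector_derivative k') (at t)"
    using assms(1)
    by (rule has_vector_derivative_transform_within_open[of _ _ _ "{a<..<b}"]) (use assms in auto)
qed

lemma Lim_eq_continuous_on:
  fixes h :: "'a::topological_space \<Rightarrow> 'b::t2_space"
  assumes "continuous_on S h" "s \<in> S" "F \<le> at s within S" "F \<noteq> bot" "\<forall>\<^sub>F t in F. k t = h t"
  shows "Lim F k = h s"
proof (rule tendsto_Lim[OF \<open>F \<noteq> bot\<close>])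
  have "(h \<longlongrightarrow> h s) F"
    using assms(1-3) tendsto_mono unfolding continuous_on_def by blast
  then show "(k \<longlongrightarrow> h s) F"
    by (rule Lim_transform_eventually) (use assms(5) in \<open>auto elim: eventually_mono\<close>)
qed

lemma Lim_at_right_continuous_on:
  fixes h :: "real \<Rightarrow> 'a::t2_space"
  assumes "continuous_on {a..b} h" "a \<le> s" "s < b" "\<And>t. a < t \<Longrightarrow> t < b \<Longrightarrow> k t = h t"
  shows "Lim (at_right s) k = h s"
proof (rule Lim_eq_continuous_on[OF assms(1)])
  show "at_right s \<le> at s within {a..b}"
    unfolding at_within_Icc_at_right[OF \<open>s < b\<close>, symmetric] using \<open>a \<le> s\<close> by (intro at_le) auto
  show "\<forall>\<^sub>F t in at_right s. k t = h t"
    using assms(2-4) by (auto simp: eventually_at_right[OF \<open>s < b\<close>])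
qed (use assms in auto)

lemma Lim_at_left_continuous_on:
  fixes h :: "real \<Rightarrow> 'a::t2_space"
  assumes "continuous_on {a..b} h" "a < s" "s \<le> b" "\<And>t. a < t \<Longrightarrow> t < b \<Longrightarrow> k t = h t"
  shows "Lim (at_left s) k = h s"
proof (rule Lim_eq_continuous_on[OF assms(1)])
  show "at_left s \<le> at s within {a..b}"
    unfolding at_within_Icc_at_left[OF \<open>a < s\<close>, symmetric] using \<open>s \<le> b\<close> by (intro at_le) auto
  show "\<forall>\<^sub>F t in at_left s. k t = h t"
    using assms(2-4) by (auto simp: eventually_at_left[OF \<open>a < s\<close>])
qed (use assms in auto)

section \<open>Lines, planes and simplices\<close>

lemma line_sgn:
  fixes u v :: "'a::real_normed_vector"
  shows "{u + c *\<^sub>R sgn v | c. True} = {u + c *\<^sub>R v | c. True}"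
proof (cases "v = 0")
  case False
  then have "u + c *\<^sub>R v = u + (c * norm v) *\<^sub>R sgn v" for c by (simp add: sgn_div_norm)
  moreover have "u + c *\<^sub>R sgn v = u + (c / norm v) *\<^sub>R v" for c
    by (simp add: sgn_div_norm divide_inverse)
  ultimately show ?thesis by (blast intro: Collect_cong)
qed simp

lemma not_collinear_if_separated:
  fixes a b c n :: "'a::euclidean_space"
  assumes "a \<noteq> b" "n \<bullet> (b - a) = 0" "n \<bullet> (c - a) \<noteq> 0"
  shows "\<not> collinear {a, b, c}"
proof
  assume "collinear {a, b, c}"
  then have "collinear {a, c, b}" by (simp add: insert_commute)
  then obtain u where "c = u *\<^sub>R a + (1 - u) *\<^sub>R b" using assms(1) unfolding collinear_3_expand by auto
  then have "c - a = (1 - u) *\<^sub>R (b - a)" by (simp add: algebra_simps)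
  then show False using assms(2,3) by simp
qed

lemma affine_plane: "affine {X. n \<bullet> (X - e) = 0}"
  using affine_hyperplane[of n "n \<bullet> e"] by (simp add: inner_diff_right)

lemma aff_dim_plane:
  fixes n :: "'a::euclidean_space"
  shows "n \<noteq> 0 \<Longrightarrow> aff_dim {X. n \<bullet> (X - e) = 0} = int (DIM('a)) - 1"
  using aff_dim_hyperplane[of n "n \<bullet> e"] by (simp add: inner_diff_right)

lemma affine_hull_3_eq_plane:
  fixes a b c n :: "'a::euclidean_space"
  assumes "DIM('a) = 3" "n \<noteq> 0" "n \<bullet> (b - a) = 0" "n \<bullet> (c - a) = 0" "\<not> collinear {a, b, c}"
  shows "affine hull {a, b, c} = {X. n \<bullet> (X - a) = 0}"
proof (rule affine_dim_equal[OF affine_affine_hull affine_plane])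
  show subset: "affine hull {a, b, c} \<subseteq> {X. n \<bullet> (X - a) = 0}"
    by (rule hull_minimal) (use assms affine_plane in auto)
  have "2 \<le> aff_dim {a, b, c}" using assms(5) by (simp add: collinear_aff_dim)
  then show "aff_dim (affine hull {a, b, c}) = aff_dim {X. n \<bullet> (X - a) = 0}"
    using aff_dim_subset[OF subset] aff_dim_plane[OF assms(2), of a] assms(1) by simp
qed auto

lemma affine_hull_3_eq_pencil_plane:
  fixes a b X n m :: "'a::euclidean_space"
  assumes "DIM('a) = 3" "a \<noteq> b" "n \<bullet> (b - a) = 0" "m \<bullet> (b - a) = 0"
    and "n \<bullet> (X - a) \<noteq> 0" "(m \<bullet> (X - a)) *\<^sub>R n \<noteq> (n \<bullet> (X - a)) *\<^sub>R m"
  shows "affine hull {a, b, X} = {Z. ((m \<bullet> (X - a)) *\<^sub>R n - (n \<bullet> (X - a)) *\<^sub>R m) \<bullet> (Z - a) = 0}"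
  using assms
  by (intro affine_hull_3_eq_plane not_collinear_if_separated[of _ _ n]) (auto simp: inner_diff_left)

lemma plane_Int_line:
  fixes n e u v :: "'a::euclidean_space"
  assumes "n \<bullet> (u - e) \<noteq> n \<bullet> (v - e)"
  shows "{X. n \<bullet> (X - e) = 0} \<inter> affine hull {u, v} =
    {u + (n \<bullet> (u - e) / (n \<bullet> (u - e) - n \<bullet> (v - e))) *\<^sub>R (v - u)}"
proof -
  have "n \<bullet> (u + k *\<^sub>R (v - u) - e) = n \<bullet> (u - e) - k * (n \<bullet> (u - e) - n \<bullet> (v - e))" for k
    by (simp add: inner_diff_right inner_add_right algebra_simps)
  then have "n \<bullet> (u + k *\<^sub>R (v - u) - e) = 0 \<longleftrightarrow> k = n \<bullet> (u - e) / (n \<bullet> (u - e) - n \<bullet> (v - e))" for k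
    using assms by (simp only:) (auto simp: field_simps)
  then show ?thesis
    unfolding affine_hull_2_alt by (auto simp only: Int_iff mem_Collect_eq image_iff singleton_iff)
qed

lemma moving_plane_Int_edge:
  fixes n e :: "real \<Rightarrow> 'a::euclidean_space" and u v :: 'a
  assumes opposite: "\<And>t. t \<in> J \<Longrightarrow> n t \<bullet> (u - e t) * (n t \<bullet> (v - e t)) < 0"
    and decreasing: "\<And>s t. s \<in> J \<Longrightarrow> t \<in> J \<Longrightarrow> s < t \<Longrightarrow>
      n t \<bullet> (u - e t) / (n t \<bullet> (v - e t)) < n s \<bullet> (u - e s) / (n s \<bullet> (v - e s))"
  obtains p where "\<And>t. t \<in> J \<Longrightarrow> {X. n t \<bullet> (X - e t) = 0} \<inter> affine hull {u, v} = {p t}"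
    "strictly_monotone_on J (\<lambda>t. dist u (p t))"
proof -
  define q where "q t = n t \<bullet> (u - e t) / (n t \<bullet> (v - e t))" for t
  define k where "k t = n t \<bullet> (u - e t) / (n t \<bullet> (u - e t) - n t \<bullet> (v - e t))" for t
  have q: "q t < 0" if "t \<in> J" for t
    using opposite[OF that] by (simp add: q_def mult_less_0_iff divide_less_0_iff)
  have k: "k t = q t / (q t - 1)" if "t \<in> J" for t
    using opposite[OF that] by (auto simp: k_def q_def field_simps)
  show ?thesis
  proof
    show "{X. n t \<bullet> (X - e t) = 0} \<inter> affine hull {u, v} = {u + k t *\<^sub>R (v - u)}" if "t \<in> J" for t
      unfolding k_def by (rule plane_Int_line) (use opposite[OF that] in \<open>auto simp: mult_less_0_iff\<close>)
    have "dist u (u + k t *\<^sub>R (v - u)) = k t * dist u v" if "t \<in> J" for t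
    proof -
      have "0 < k t" unfolding k[OF that] using q[OF that] by (intro divide_neg_neg) auto
      then show ?thesis by (simp add: dist_norm norm_minus_commute)
    qed
    moreover have "k s * dist u v < k t * dist u v" if "s \<in> J" "t \<in> J" "s < t" for s t
    proof (rule mult_strict_right_mono)
      show "k s < k t"
        using decreasing[OF that, folded q_def] q[OF that(1)] q[OF that(2)]
        unfolding k[OF that(1)] k[OF that(2)] by (simp add: divide_less_eq less_divide_eq algebra_simps)
      show "0 < dist u v" using opposite[OF that(1)] by (auto simp: mult_less_0_iff)
    qed
    ultimately show "strictly_monotone_on J (\<lambda>t. dist u (u + k t *\<^sub>R (v - u)))"
      unfolding strictly_monotone_on_def by auto
  qed
qed

lemma pencil_plane_Int_opposite_edge:
  fixes a b u v n m :: "'a::euclidean_space" and X :: "real \<Rightarrow> 'a"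
  assumes dim: "DIM('a) = 3" and "a \<noteq> b" and axis: "n \<bullet> (b - a) = 0" "m \<bullet> (b - a) = 0"
    and u: "n \<bullet> (u - a) = 0" "0 < m \<bullet> (u - a)" and v: "0 < n \<bullet> (v - a)" "m \<bullet> (v - a) = 0"
    and X: "\<And>t. t \<in> J \<Longrightarrow> 0 < n \<bullet> (X t - a) \<and> 0 < m \<bullet> (X t - a)"
    and increasing: "\<And>s t. s \<in> J \<Longrightarrow> t \<in> J \<Longrightarrow> s < t \<Longrightarrow>
      n \<bullet> (X s - a) / (m \<bullet> (X s - a)) < n \<bullet> (X t - a) / (m \<bullet> (X t - a))"
  obtains p where "\<And>t. t \<in> J \<Longrightarrow> \<not> collinear {a, b, X t}"
    "\<And>t. t \<in> J \<Longrightarrow> affine hull {a, b, X t} \<inter> affine hull {u, v} = {p t}"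
    "strictly_monotone_on J (\<lambda>t. dist u (p t))"
proof -
  define N where "N t = (m \<bullet> (X t - a)) *\<^sub>R n - (n \<bullet> (X t - a)) *\<^sub>R m" for t
  have Nu: "N t \<bullet> (u - a) = - (n \<bullet> (X t - a)) * (m \<bullet> (u - a))"
    and Nv: "N t \<bullet> (v - a) = (m \<bullet> (X t - a)) * (n \<bullet> (v - a))" for t
    using u v by (simp_all add: N_def inner_diff_left)
  have hull: "affine hull {a, b, X t} = {Z. N t \<bullet> (Z - a) = 0}" if "t \<in> J" for t
    unfolding N_def
  proof (rule affine_hull_3_eq_pencil_plane[OF dim \<open>a \<noteq> b\<close> axis])
    show "(m \<bullet> (X t - a)) *\<^sub>R n \<noteq> (n \<bullet> (X t - a)) *\<^sub>R m"
      using Nv[of t] X[OF that] v by (auto simp: N_def)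
  qed (use X[OF that] in simp)
  have opposite: "N t \<bullet> (u - a) * (N t \<bullet> (v - a)) < 0" if "t \<in> J" for t
    unfolding Nu Nv using X[OF that] u v by (intro mult_neg_pos) (auto simp: mult_neg_pos)
  have "N t \<bullet> (u - a) / (N t \<bullet> (v - a)) =
      - (n \<bullet> (X t - a) / (m \<bullet> (X t - a)) * (m \<bullet> (u - a) / (n \<bullet> (v - a))))" for t
    by (simp add: Nu Nv)
  then have decreasing: "N t \<bullet> (u - a) / (N t \<bullet> (v - a)) < N s \<bullet> (u - a) / (N s \<bullet> (v - a))"
    if "s \<in> J" "t \<in> J" "s < t" for s t
    using mult_strict_right_mono[OF increasing[OF that] divide_pos_pos[OF u(2) v(1)]] by simp
  obtain p where p: "\<And>t. t \<in> J \<Longrightarrow> {Z. N t \<bullet> (Z - a) = 0} \<inter> affine hull {u, v} = {p t}"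
    "strictly_monotone_on J (\<lambda>t. dist u (p t))"
    using moving_plane_Int_edge[of J N u "\<lambda>_. a" v, OF opposite decreasing] by blast
  show ?thesis
  proof
    show "\<not> collinear {a, b, X t}" if "t \<in> J" for t
      using not_collinear_if_separated[OF \<open>a \<noteq> b\<close> axis(1)] X[OF that] by force
  qed (use p hull in auto)
qed

lemma infdist_plane:
  fixes n e X :: "'a::euclidean_space"
  assumes "n \<noteq> 0"
  shows "infdist X {Z. n \<bullet> (Z - e) = 0} = \<bar>n \<bullet> (X - e)\<bar> / norm n"
proof (rule antisym)
  let ?foot = "X - (n \<bullet> (X - e) / (n \<bullet> n)) *\<^sub>R n"
  have "?foot \<in> {Z. n \<bullet> (Z - e) = 0}" using assms by (simp add: inner_diff_right)
  then have "infdist X {Z. n \<bullet> (Z - e) = 0} \<le> dist X ?foot" by (rule infdist_le)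
  also have "\<dots> = \<bar>n \<bullet> (X - e)\<bar> / norm n"
    by (simp add: dist_norm power2_norm_eq_inner[symmetric] power2_eq_square)
  finally show "infdist X {Z. n \<bullet> (Z - e) = 0} \<le> \<bar>n \<bullet> (X - e)\<bar> / norm n" .
next
  have "{Z. n \<bullet> (Z - e) = 0} \<noteq> {}" by (auto intro: exI[of _ e])
  moreover have "\<bar>n \<bullet> (X - e)\<bar> / norm n \<le> dist X Z" if "n \<bullet> (Z - e) = 0" for Z
  proof -
    have "n \<bullet> (X - e) = n \<bullet> (X - Z)" using that by (simp add: inner_diff_right)
    also have "\<bar>\<dots>\<bar> \<le> norm n * norm (X - Z)" by (rule Cauchy_Schwarz_ineq2)
    finally show ?thesis using assms by (simp add: dist_norm field_simps)
  qed
  ultimately show "\<bar>n \<bullet> (X - e)\<bar> / norm n \<le> infdist X {Z. n \<bullet> (Z - e) = 0}"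
    by (auto simp: infdist_notempty intro!: cINF_greatest)
qed

lemma farthest_points_plane:
  fixes r :: "real \<Rightarrow> real ^ 3"
  assumes "n \<noteq> 0" "c \<in> {a..b}"
    and nonneg: "\<And>t. a \<le> t \<Longrightarrow> t \<le> b \<Longrightarrow> 0 \<le> n \<bullet> (r t - e)"
    and max: "\<And>t. a \<le> t \<Longrightarrow> t \<le> b \<Longrightarrow> t \<noteq> c \<Longrightarrow> n \<bullet> (r t - e) < n \<bullet> (r c - e)"
  shows "farthest_points r a b {X. n \<bullet> (X - e) = 0} = {r c}"
proof -
  have dist: "infdist (r t) {X. n \<bullet> (X - e) = 0} = n \<bullet> (r t - e) / norm n" if "a \<le> t" "t \<le> b" for t
    using infdist_plane[OF \<open>n \<noteq> 0\<close>] nonneg[OF that] by simp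
  have "infdist (r s) {X. n \<bullet> (X - e) = 0} \<le> infdist (r t) {X. n \<bullet> (X - e) = 0} \<longleftrightarrow>
      n \<bullet> (r s - e) \<le> n \<bullet> (r t - e)" if "s \<in> {a..b}" "t \<in> {a..b}" for s t
    using that \<open>n \<noteq> 0\<close> by (simp add: dist divide_le_cancel)
  then have "farthest_points r a b {X. n \<bullet> (X - e) = 0} =
      r ` {t \<in> {a..b}. \<forall>s\<in>{a..b}. n \<bullet> (r s - e) \<le> n \<bullet> (r t - e)}"
    unfolding farthest_points_def by auto
  also have "{t \<in> {a..b}. \<forall>s\<in>{a..b}. n \<bullet> (r s - e) \<le> n \<bullet> (r t - e)} = {c}"
    using assms(2) max by (fastforce simp: not_less[symmetric] intro: less_imp_le)
  finally show ?thesis by simp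
qed

lemma parallel_to_plane_iff:
  "parallel_to_plane v {Z. n \<bullet> (Z - e) = 0} \<longleftrightarrow> n \<bullet> v = 0"
proof
  show "n \<bullet> v = 0" if "parallel_to_plane v {Z. n \<bullet> (Z - e) = 0}"
    using that by (auto simp: parallel_to_plane_def algebra_simps inner_add_right inner_diff_right)
  show "parallel_to_plane v {Z. n \<bullet> (Z - e) = 0}" if "n \<bullet> v = 0"
    using that unfolding parallel_to_plane_def by (intro bexI[of _ e]) auto
qed

lemma coplanar_imp_aff_dim_le: "coplanar S \<Longrightarrow> aff_dim S \<le> 2"
  for S :: "'a::euclidean_space set"
proof -
  assume "coplanar S"
  then obtain u v w where "S \<subseteq> affine hull {u, v, w}" unfolding coplanar_def by blast
  from aff_dim_subset[OF this] have "aff_dim S \<le> aff_dim {u, v, w}" by simp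
  also have "\<dots> \<le> int (card {u, v, w}) - 1" by (rule aff_dim_le_card) simp
  also have "\<dots> \<le> 2" by (simp add: card_insert_if)
  finally show ?thesis .
qed

definition facet_normal :: "'a::real_inner set \<Rightarrow> 'a \<Rightarrow> 'a \<Rightarrow> 'a \<Rightarrow> bool" where
  "facet_normal S v n e \<longleftrightarrow> (\<forall>u\<in>S - {v}. n \<bullet> (u - e) = 0) \<and> 0 < n \<bullet> (v - e)"

lemma affine_independent_if_facet_normals:
  fixes S :: "'a::euclidean_space set"
  assumes "\<And>v. v \<in> S \<Longrightarrow> \<exists>n e. facet_normal S v n e"
  shows "\<not> affine_dependent S"
proof
  assume "affine_dependent S"
  then obtain v where v: "v \<in> S" "v \<in> affine hull (S - {v})" unfolding affine_dependent_def by blast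
  obtain n e where normal: "facet_normal S v n e" using assms v(1) by blast
  have "affine hull (S - {v}) \<subseteq> {X. n \<bullet> (X - e) = 0}"
    by (rule hull_minimal) (use normal affine_plane in \<open>auto simp: facet_normal_def\<close>)
  then show False using v(2) normal by (auto simp: facet_normal_def)
qed

lemma affine_hull_facet:
  fixes S :: "'a::euclidean_space set"
  assumes "\<not> affine_dependent S" "card S = DIM('a) + 1" "v \<in> S" "facet_normal S v n e"
  shows "affine hull (S - {v}) = {X. n \<bullet> (X - e) = 0}"
proof (rule affine_dim_equal[OF affine_affine_hull affine_plane])
  show "affine hull (S - {v}) \<subseteq> {X. n \<bullet> (X - e) = 0}"
    by (rule hull_minimal) (use assms(4) affine_plane in \<open>auto simp: facet_normal_def\<close>)
  have "\<not> affine_dependent (S - {v})" using assms(1) affine_independent_subset by blast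
  moreover have "n \<noteq> 0" using assms(4) by (auto simp: facet_normal_def)
  moreover have "card (S - {v}) = DIM('a)" using assms(2,3) by simp
  ultimately show "aff_dim (affine hull (S - {v})) = aff_dim {X. n \<bullet> (X - e) = 0}"
    using aff_dim_affine_independent[of "S - {v}"] by (simp add: aff_dim_plane)
  have "card (S - {v}) > 0" using assms(2,3) by simp
  then show "affine hull (S - {v}) \<noteq> {}" by (auto simp: card_gt_0_iff)
qed

lemma mem_convex_hull_if_facet_normals:
  fixes S :: "'a::euclidean_space set"
  assumes card: "card S = DIM('a) + 1"
    and normals: "\<And>v. v \<in> S \<Longrightarrow> \<exists>n e. facet_normal S v n e \<and> 0 \<le> n \<bullet> (X - e)"
  shows "X \<in> convex hull S"
proof -
  have "finite S" using card card.infinite by fastforce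
  have "\<exists>n e. facet_normal S v n e" if "v \<in> S" for v using normals[OF that] by blast
  then have "\<not> affine_dependent S" by (rule affine_independent_if_facet_normals)
  then have "aff_dim S = DIM('a)" using card aff_dim_affine_independent[of S] by simp
  then have "affine hull S = UNIV" by (simp only: aff_dim_eq_full)
  then obtain k where k: "sum k S = 1" "(\<Sum>v\<in>S. k v *\<^sub>R v) = X"
    unfolding affine_hull_finite[OF \<open>finite S\<close>] by blast
  have "0 \<le> k v" if v: "v \<in> S" for v
  proof -
    obtain n e where n: "facet_normal S v n e" "0 \<le> n \<bullet> (X - e)" using normals[OF v] by blast
    have "X - e = (\<Sum>u\<in>S. k u *\<^sub>R (u - e))"
      using k by (simp add: scaleR_diff_right sum_subtractf flip: scaleR_left.sum)
    then have "n \<bullet> (X - e) = (\<Sum>u\<in>S. k u * (n \<bullet> (u - e)))" by (simp add: inner_sum_right)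
    also have "\<dots> = k v * (n \<bullet> (v - e))"
      using n(1) \<open>finite S\<close> v by (subst sum.remove[of _ v]) (auto simp: facet_normal_def)
    finally show ?thesis using n by (auto simp: facet_normal_def zero_le_mult_iff)
  qed
  then show ?thesis unfolding convex_hull_finite[OF \<open>finite S\<close>] using k by auto
qed

locale tetrahedron =
  fixes v0 v1 v2 v3 n0 n1 n2 n3 :: "real ^ 3"
  assumes face0: "0 < n0 \<bullet> (v0 - v3)" "n0 \<bullet> (v1 - v3) = 0" "n0 \<bullet> (v2 - v3) = 0"
    and face1: "0 < n1 \<bullet> (v1 - v0)" "n1 \<bullet> (v2 - v0) = 0" "n1 \<bullet> (v3 - v0) = 0"
    and face2: "0 < n2 \<bullet> (v2 - v0)" "n2 \<bullet> (v1 - v0) = 0" "n2 \<bullet> (v3 - v0) = 0"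
    and face3: "0 < n3 \<bullet> (v3 - v0)" "n3 \<bullet> (v1 - v0) = 0" "n3 \<bullet> (v2 - v0) = 0"
begin

lemma vertices_distinct:
  "v0 \<noteq> v1" "v0 \<noteq> v2" "v0 \<noteq> v3" "v1 \<noteq> v2" "v1 \<noteq> v3" "v2 \<noteq> v3"
  using face0 face1 face2 by auto

lemma card_vertices: "card {v0, v1, v2, v3} = DIM(real ^ 3) + 1"
  using vertices_distinct by simp

lemma facet_normals:
  "facet_normal {v0, v1, v2, v3} v0 n0 v3" "facet_normal {v0, v1, v2, v3} v1 n1 v0"
  "facet_normal {v0, v1, v2, v3} v2 n2 v0" "facet_normal {v0, v1, v2, v3} v3 n3 v0"
  using face0 face1 face2 face3 by (auto simp: facet_normal_def)

lemma independent: "\<not> affine_dependent {v0, v1, v2, v3}"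
  using facet_normals by (intro affine_independent_if_facet_normals) blast

lemma not_coplanar: "\<not> coplanar {v0, v1, v2, v3}"
  using coplanar_imp_aff_dim_le[of "{v0, v1, v2, v3}"] aff_dim_affine_independent[OF independent]
  unfolding card_vertices by auto

lemma mem_convex_hull:
  assumes "0 \<le> n0 \<bullet> (X - v3)" "0 \<le> n1 \<bullet> (X - v0)" "0 \<le> n2 \<bullet> (X - v0)" "0 \<le> n3 \<bullet> (X - v0)"
  shows "X \<in> convex hull {v0, v1, v2, v3}"
  using assms facet_normals by (intro mem_convex_hull_if_facet_normals[OF card_vertices]) blast

lemma affine_hull_faces:
  "affine hull {v1, v2, v3} = {X. n0 \<bullet> (X - v3) = 0}"
  "affine hull {v0, v2, v3} = {X. n1 \<bullet> (X - v0) = 0}"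
  "affine hull {v0, v1, v3} = {X. n2 \<bullet> (X - v0) = 0}"
  "affine hull {v0, v1, v2} = {X. n3 \<bullet> (X - v0) = 0}"
  using facet_normals[THEN affine_hull_facet[OF independent card_vertices, rotated]] vertices_distinct
  by (simp_all add: insert_Diff_if)

end

section \<open>Oriented volumes\<close>

lemma dual_basis_expansion:
  fixes m1 m2 m3 v :: "real ^ 3"
  shows "(cross3 m1 m2 \<bullet> m3) *\<^sub>R v =
    (m1 \<bullet> v) *\<^sub>R cross3 m2 m3 + (m2 \<bullet> v) *\<^sub>R cross3 m3 m1 + (m3 \<bullet> v) *\<^sub>R cross3 m1 m2"
  by (simp add: vec_eq_iff forall_3 inner_vec_def sum_3 cross_components algebra_simps)

lemma dual_basis:
  fixes m1 m2 m3 :: "real ^ 3"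
  assumes "cross3 m1 m2 \<bullet> m3 \<noteq> 0"
  obtains e1 e2 e3 where "cross3 e1 e2 \<bullet> e3 \<noteq> 0"
    "\<And>v. v = (m1 \<bullet> v) *\<^sub>R e1 + (m2 \<bullet> v) *\<^sub>R e2 + (m3 \<bullet> v) *\<^sub>R e3"
proof -
  define d where "d = cross3 m1 m2 \<bullet> m3"
  have "cross3 (cross3 m2 m3) (cross3 m3 m1) = d *\<^sub>R m3"
    by (simp add: d_def Lagrange dot_cross_self cross_triple[of m2 m3 m1] cross_triple[of m1 m2 m3])
  then have "cross3 ((1 / d) *\<^sub>R cross3 m2 m3) ((1 / d) *\<^sub>R cross3 m3 m1) \<bullet> ((1 / d) *\<^sub>R cross3 m1 m2) \<noteq> 0"
    using assms by (simp add: cross_mult_left cross_mult_right d_def inner_commute)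
  moreover have "v = (m1 \<bullet> v) *\<^sub>R (1 / d) *\<^sub>R cross3 m2 m3 + (m2 \<bullet> v) *\<^sub>R (1 / d) *\<^sub>R cross3 m3 m1
      + (m3 \<bullet> v) *\<^sub>R (1 / d) *\<^sub>R cross3 m1 m2" for v
    using arg_cong[OF dual_basis_expansion[of m1 m2 m3 v], of "scaleR (1 / d)"] assms
    by (simp add: d_def scaleR_add_right mult.commute)
  ultimately show ?thesis using that by blast
qed

locale volume_form =
  fixes \<kappa> :: real
begin

definition normal :: "real ^ 3 \<Rightarrow> real ^ 3 \<Rightarrow> real ^ 3" where
  "normal u v = \<kappa> *\<^sub>R cross3 u v"

definition vol :: "real ^ 3 \<Rightarrow> real ^ 3 \<Rightarrow> real ^ 3 \<Rightarrow> real" where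
  "vol u v w = normal u v \<bullet> w"

lemma vol_repeated [simp]: "vol u u v = 0" "vol u v u = 0" "vol u v v = 0"
  by (simp_all add: vol_def normal_def dot_cross_self)

lemma vol_zero [simp]: "vol 0 u v = 0" "vol u 0 v = 0" "vol u v 0 = 0"
  by (simp_all add: vol_def normal_def)

lemma vol_scaleR [simp]:
  "vol (c *\<^sub>R u) v w = c * vol u v w" "vol u (c *\<^sub>R v) w = c * vol u v w"
  "vol u v (c *\<^sub>R w) = c * vol u v w"
  by (simp_all add: vol_def normal_def cross_mult_left cross_mult_right)

lemma vol_minus [simp]:
  "vol (- u) v w = - vol u v w" "vol u (- v) w = - vol u v w" "vol u v (- w) = - vol u v w"
  by (simp_all add: vol_def normal_def)

lemma vol_add:
  "vol (u + u') v w = vol u v w + vol u' v w" "vol u (v + v') w = vol u v w + vol u v' w"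
  "vol u v (w + w') = vol u v w + vol u v w'"
  by (simp_all add: vol_def normal_def cross_add_left cross_add_right algebra_simps inner_add_left
      inner_add_right)

lemma vol_diff:
  "vol (u - u') v w = vol u v w - vol u' v w" "vol u (v - v') w = vol u v w - vol u v' w"
  "vol u v (w - w') = vol u v w - vol u v w'"
  using vol_add(1)[of u "- u'" v w] vol_add(2)[of u v "- v'" w] vol_add(3)[of u v w "- w'"]
  by simp_all

lemma vol_rotate: "vol u v w = vol v w u" "vol u v w = vol w u v"
  using cross_triple[of u v w] cross_triple[of w u v] by (simp_all add: vol_def normal_def)

lemma vol_swap: "vol u v w = - vol v u w" "vol u v w = - vol u w v"
proof -
  show swap12: "vol u v w = - vol v u w" for u v w
    using cross_skew[of u v] by (simp add: vol_def normal_def)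
  show "vol u v w = - vol u w v"
    using swap12[of v w u] by (simp add: vol_rotate)
qed

lemma cramer: "vol u v w *\<^sub>R z = vol z v w *\<^sub>R u + vol u z w *\<^sub>R v + vol u v z *\<^sub>R w"
  by (simp add: vec_eq_iff forall_3 vol_def normal_def inner_vec_def sum_3 cross_components
      algebra_simps)

lemma plucker: "vol z u v * vol z w x = vol z u w * vol z v x - vol z u x * vol z v w"
proof -
  have "vol z u v *\<^sub>R w = vol w u v *\<^sub>R z + vol z w v *\<^sub>R u + vol z u w *\<^sub>R v" by (rule cramer)
  then have "vol z u v * vol z w x = vol z w v * vol z u x + vol z u w * vol z v x"
    by (metis (no_types) vol_scaleR(2) vol_add(2) vol_repeated(1) mult_zero_right add_0)
  then show ?thesis using vol_swap(2)[of z w v] by simp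
qed

text \<open>Here \<open>w\<close> spans the intersection of the planes \<open>p q\<close> and \<open>s u\<close>, and the bracket on the right compares
  the heights of \<open>x\<close> and \<open>y\<close> above these planes.\<close>

lemma vol_line_of_planes:
  assumes "vol p q w = 0" "vol s u w = 0" "vol p w s \<noteq> 0"
  shows "vol x y w * (vol p q s * vol s u p) =
    vol p w s * (vol p q x * vol s u y - vol s u x * vol p q y)"
proof -
  let ?d = "vol p w s"
  have expand: "?d *\<^sub>R z = vol z w s *\<^sub>R p + vol p z s *\<^sub>R w + vol p w z *\<^sub>R s" for z
    by (rule cramer)
  have left: "?d * vol p q z = vol p w z * vol p q s" for z
    using arg_cong[OF expand, of "vol p q" z] by (simp add: vol_add assms)
  have right: "?d * vol s u z = vol z w s * vol s u p" for z
    using arg_cong[OF expand, of "vol s u" z] by (simp add: vol_add assms)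
  have cross: "?d * vol x y w = vol p w x * vol y w s - vol x w s * vol p w y"
    using plucker[of w x y p s] vol_swap(1)[of w p s] vol_swap(1)[of w x s] vol_swap(1)[of w y s]
    by (simp add: vol_rotate algebra_simps)
  have "?d * (vol x y w * (vol p q s * vol s u p)) = (?d * vol x y w) * (vol p q s * vol s u p)"
    by simp
  also have "\<dots> = (vol p w x * vol p q s) * (vol y w s * vol s u p)
      - (vol x w s * vol s u p) * (vol p w y * vol p q s)"
    unfolding cross by (simp add: algebra_simps)
  also have "\<dots> = (?d * vol p q x) * (?d * vol s u y) - (?d * vol s u x) * (?d * vol p q y)"
    by (simp only: left right)
  also have "\<dots> = ?d * (?d * (vol p q x * vol s u y - vol s u x * vol p q y))"
    by (simp add: algebra_simps)
  finally show ?thesis using assms(3) by simp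
qed

lemma has_real_derivative_vol:
  assumes "(f has_vector_derivative f') (at t)" "(g has_vector_derivative g') (at t)"
    "(h has_vector_derivative h') (at t)"
  shows "((\<lambda>t. vol (f t) (g t) (h t)) has_real_derivative
    vol f' (g t) (h t) + vol (f t) g' (h t) + vol (f t) (g t) h') (at t)"
proof -
  have cross: "bounded_bilinear cross3"
    by (simp add: bilinear_cross bilinear_conv_bounded_bilinear[symmetric])
  have "((\<lambda>t. \<kappa> *\<^sub>R cross3 (f t) (g t)) has_vector_derivative
      \<kappa> *\<^sub>R (cross3 (f t) g' + cross3 f' (g t))) (at t)"
    by (intro bounded_linear.has_vector_derivative[OF bounded_linear_scaleR_right]
        bounded_bilinear.has_vector_derivative[OF cross] assms)
  from bounded_bilinear.has_vector_derivative[OF bounded_bilinear_inner this assms(3)]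
  show ?thesis
    unfolding has_real_derivative_iff_has_vector_derivative vol_def normal_def
    by (simp add: inner_add_left algebra_simps)
qed

lemma continuous_on_vol:
  fixes f g h :: "'a::t2_space \<Rightarrow> real ^ 3"
  shows "continuous_on S f \<Longrightarrow> continuous_on S g \<Longrightarrow> continuous_on S h \<Longrightarrow>
    continuous_on S (\<lambda>t. vol (f t) (g t) (h t))"
  unfolding vol_def normal_def by (intro continuous_intros continuous_on_cross)

end

section \<open>Positive frames\<close>

text \<open>The scale \<open>\<kappa>\<close> makes the frame have volume one. Its sign is the handedness of the curve, so that
  no inequality below depends on the sign of the torsion. Only \<open>T\<close> and \<open>N\<close>, not \<open>r'\<close>, have to be
  nonzero at the endpoints: the curve may be singular there.\<close>

locale positive_frame = volume_form \<kappa> for \<kappa> +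
  fixes a b :: real and r T N :: "real \<Rightarrow> real ^ 3" and B :: "real ^ 3" and \<rho> \<sigma> \<omega> :: "real \<Rightarrow> real"
  assumes less: "a < b"
    and r_cont: "continuous_on {a..b} r"
    and T_cont: "continuous_on {a..b} T"
    and N_cont: "continuous_on {a..b} N"
    and r_deriv: "\<And>t. a < t \<Longrightarrow> t < b \<Longrightarrow> (r has_vector_derivative \<rho> t *\<^sub>R T t) (at t)"
    and T_deriv: "\<And>t. a < t \<Longrightarrow> t < b \<Longrightarrow> (T has_vector_derivative \<sigma> t *\<^sub>R N t) (at t)"
    and N_deriv: "\<And>t. a < t \<Longrightarrow> t < b \<Longrightarrow> (N has_vector_derivative \<omega> t *\<^sub>R B) (at t)"
    and \<rho>_pos: "\<And>t. a < t \<Longrightarrow> t < b \<Longrightarrow> 0 < \<rho> t"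
    and \<sigma>_pos: "\<And>t. a < t \<Longrightarrow> t < b \<Longrightarrow> 0 < \<sigma> t"
    and \<omega>_pos: "\<And>t. a < t \<Longrightarrow> t < b \<Longrightarrow> 0 < \<omega> t"
    and unimodular: "\<And>t. a \<le> t \<Longrightarrow> t \<le> b \<Longrightarrow> vol (T t) (N t) B = 1"
begin

lemmas continuous = r_cont T_cont N_cont
lemmas frenet = r_deriv T_deriv N_deriv
lemmas rates_pos = \<rho>_pos \<sigma>_pos \<omega>_pos

lemma subframe:
  assumes "a \<le> s" "s < t" "t \<le> b"
  shows "positive_frame \<kappa> s t r T N B \<rho> \<sigma> \<omega>"
  by unfold_locales
    (use assms frenet rates_pos unimodular in \<open>auto intro: continuous[THEN continuous_on_subset]\<close>)

lemma reverse:
  "positive_frame \<kappa> (- b) (- a) (\<lambda>t. r (- t)) (\<lambda>t. - T (- t)) (\<lambda>t. N (- t)) (- B)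
     (\<lambda>t. \<rho> (- t)) (\<lambda>t. \<sigma> (- t)) (\<lambda>t. \<omega> (- t))"
proof unfold_locales
  have reflect: "continuous_on {- b..- a} (\<lambda>t. h (- t))" if "continuous_on {a..b} h"
    for h :: "real \<Rightarrow> real ^ 3"
    by (rule continuous_on_compose2[OF that]) (auto intro!: continuous_intros)
  show "continuous_on {- b..- a} (\<lambda>t. r (- t))" "continuous_on {- b..- a} (\<lambda>t. - T (- t))"
    "continuous_on {- b..- a} (\<lambda>t. N (- t))"
    by (intro continuous_on_minus reflect continuous)+
next
  fix t assume "- b < t" "t < - a"
  then have t: "a < - t" "- t < b" by auto
  then show "0 < \<rho> (- t)" "0 < \<sigma> (- t)" "0 < \<omega> (- t)" by (rule rates_pos)+
  have reflect: "((\<lambda>t. h (- t)) has_vector_derivative - h') (at t)"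
    if "(h has_vector_derivative h') (at (- t))" for h :: "real \<Rightarrow> real ^ 3" and h'
    using vector_diff_chain_at[of uminus "- 1" t h h'] that
    by (simp add: o_def has_vector_derivative_minus[OF has_vector_derivative_id])
  show "((\<lambda>t. r (- t)) has_vector_derivative \<rho> (- t) *\<^sub>R - T (- t)) (at t)"
    "((\<lambda>t. - T (- t)) has_vector_derivative \<sigma> (- t) *\<^sub>R N (- t)) (at t)"
    "((\<lambda>t. N (- t)) has_vector_derivative \<omega> (- t) *\<^sub>R - B) (at t)"
    using reflect[OF r_deriv[OF t]] has_vector_derivative_minus[OF reflect[OF T_deriv[OF t]]]
      reflect[OF N_deriv[OF t]] by simp_all
qed (use less in \<open>auto simp: unimodular\<close>)

lemma frenet_chord: "a < t \<Longrightarrow> t < b \<Longrightarrow> ((\<lambda>t. r t - e) has_vector_derivative \<rho> t *\<^sub>R T t) (at t)"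
  "a < t \<Longrightarrow> t < b \<Longrightarrow> ((\<lambda>t. e - r t) has_vector_derivative - (\<rho> t *\<^sub>R T t)) (at t)"
  using has_vector_derivative_diff[OF r_deriv has_vector_derivative_const]
    has_vector_derivative_diff[OF has_vector_derivative_const r_deriv] by simp_all

lemma
  assumes "a < t" "t < b"
  shows DERIV_vol_u_v_N: "((\<lambda>t. vol u v (N t)) has_real_derivative \<omega> t * vol u v B) (at t)"
    and DERIV_vol_u_v_T: "((\<lambda>t. vol u v (T t)) has_real_derivative \<sigma> t * vol u v (N t)) (at t)"
    and DERIV_vol_u_v_r: "((\<lambda>t. vol u v (r t - e)) has_real_derivative \<rho> t * vol u v (T t)) (at t)"
    and DERIV_vol_u_N_v: "((\<lambda>t. vol u (N t) v) has_real_derivative \<omega> t * vol u B v) (at t)"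
    and DERIV_vol_u_T_v: "((\<lambda>t. vol u (T t) v) has_real_derivative \<sigma> t * vol u (N t) v) (at t)"
    and DERIV_vol_u_r_v: "((\<lambda>t. vol u (r t - e) v) has_real_derivative \<rho> t * vol u (T t) v) (at t)"
    and DERIV_vol_u_T_N: "((\<lambda>t. vol u (T t) (N t)) has_real_derivative \<omega> t * vol u (T t) B) (at t)"
    and DERIV_vol_u_r_T: "((\<lambda>t. vol u (r t - e) (T t)) has_real_derivative
           \<sigma> t * vol u (r t - e) (N t)) (at t)"
    and DERIV_vol_u_r_N: "((\<lambda>t. vol u (r t - e) (N t)) has_real_derivative
           \<rho> t * vol u (T t) (N t) + \<omega> t * vol u (r t - e) B) (at t)"
    and DERIV_vol_r_u_v: "((\<lambda>t. vol (r t - e) u v) has_real_derivative \<rho> t * vol (T t) u v) (at t)"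
    and DERIV_vol_r_N_B: "((\<lambda>t. vol (r t - e) (N t) B) has_real_derivative \<rho> t) (at t)"
    and DERIV_vol_r_T_B: "((\<lambda>t. vol (r t - e) (T t) B) has_real_derivative
           \<sigma> t * vol (r t - e) (N t) B) (at t)"
    and DERIV_vol_r_T_N: "((\<lambda>t. vol (r t - e) (T t) (N t)) has_real_derivative
           \<omega> t * vol (r t - e) (T t) B) (at t)"
    and DERIV_vol_T_N_minus_r: "((\<lambda>t. vol (T t) (N t) (e - r t)) has_real_derivative
           \<omega> t * vol (T t) B (e - r t)) (at t)"
    and DERIV_vol_minus_r_u_v: "((\<lambda>t. vol (e - r t) u v) has_real_derivative
           - (\<rho> t * vol (T t) u v)) (at t)"
  using assms unimodular[of t]
  by (auto intro!: has_real_derivative_vol[THEN DERIV_cong] frenet frenet_chord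
      has_vector_derivative_const)

lemmas vol_pos_intros =
  continuous_intros continuous_on_vol continuous mult_pos_pos add_pos_pos rates_pos

lemma vol_T_N_B:
  assumes "a \<le> s" "s \<le> t" "t \<le> b"
  shows "vol (T s) (N t) B = 1"
proof (cases "s = t")
  case False
  have "vol (T s) (N t) B = vol (T s) (N s) B"
  proof (rule DERIV_isconst_end[where f = "\<lambda>t. vol (T s) (N t) B"])
    show "((\<lambda>t. vol (T s) (N t) B) has_real_derivative 0) (at z)" if "s < z" "z < t" for z
      using DERIV_vol_u_N_v[of z "T s" B] that assms by simp
    show "continuous_on {s..t} (\<lambda>t. vol (T s) (N t) B)"
      using assms by (intro continuous_on_vol continuous_on_const continuous_on_subset[OF N_cont]) auto
  qed (use False assms in auto)
  then show ?thesis using unimodular assms by simp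
qed (use unimodular assms in auto)

lemma vol_T_N_N_pos: "a \<le> s \<Longrightarrow> s < t \<Longrightarrow> t \<le> b \<Longrightarrow> 0 < vol (T s) (N s) (N t)"
  by (rule DERIV_pos_imp_pos[OF _ _ _ DERIV_vol_u_v_N])
    (auto intro!: vol_pos_intros simp: unimodular)

lemma vol_T_N_T_pos: "a \<le> s \<Longrightarrow> s < t \<Longrightarrow> t \<le> b \<Longrightarrow> 0 < vol (T s) (N s) (T t)"
  by (rule DERIV_pos_imp_pos[OF _ _ _ DERIV_vol_u_v_T])
    (auto intro!: vol_pos_intros vol_T_N_N_pos)

lemma vol_T_N_r_pos: "a \<le> s \<Longrightarrow> s < t \<Longrightarrow> t \<le> b \<Longrightarrow> 0 < vol (T s) (N s) (r t - r s)"
  by (rule DERIV_pos_imp_pos[OF _ _ _ DERIV_vol_u_v_r])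
    (auto intro!: vol_pos_intros vol_T_N_T_pos)

lemma vol_T_T_B_pos: "a \<le> s \<Longrightarrow> s < t \<Longrightarrow> t \<le> b \<Longrightarrow> 0 < vol (T s) (T t) B"
  by (rule DERIV_pos_imp_pos[OF _ _ _ DERIV_vol_u_T_v])
    (auto intro!: vol_pos_intros simp: vol_T_N_B)

lemma vol_T_T_N_pos: "a \<le> s \<Longrightarrow> s < t \<Longrightarrow> t \<le> b \<Longrightarrow> 0 < vol (T s) (T t) (N t)"
  by (rule DERIV_pos_imp_pos[OF _ _ _ DERIV_vol_u_T_N])
    (auto intro!: vol_pos_intros vol_T_T_B_pos)

lemma vol_r_N_B_pos: "a \<le> s \<Longrightarrow> s < t \<Longrightarrow> t \<le> b \<Longrightarrow> 0 < vol (r t - r s) (N t) B"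
  by (rule DERIV_pos_imp_pos[OF _ _ _ DERIV_vol_r_N_B])
    (auto intro!: vol_pos_intros)

lemma vol_r_T_B_pos: "a \<le> s \<Longrightarrow> s < t \<Longrightarrow> t \<le> b \<Longrightarrow> 0 < vol (r t - r s) (T t) B"
  by (rule DERIV_pos_imp_pos[OF _ _ _ DERIV_vol_r_T_B])
    (auto intro!: vol_pos_intros vol_r_N_B_pos)

lemma vol_r_T_N_pos: "a \<le> s \<Longrightarrow> s < t \<Longrightarrow> t \<le> b \<Longrightarrow> 0 < vol (r t - r s) (T t) (N t)"
  by (rule DERIV_pos_imp_pos[OF _ _ _ DERIV_vol_r_T_N])
    (auto intro!: vol_pos_intros vol_r_T_B_pos)

lemma vol_T_r_B_pos: "a \<le> s \<Longrightarrow> s < t \<Longrightarrow> t \<le> b \<Longrightarrow> 0 < vol (T s) (r t - r s) B"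
  by (rule DERIV_pos_imp_pos[OF _ _ _ DERIV_vol_u_r_v])
    (auto intro!: vol_pos_intros vol_T_T_B_pos)

lemma vol_T_r_N_pos: "a \<le> s \<Longrightarrow> s < t \<Longrightarrow> t \<le> b \<Longrightarrow> 0 < vol (T s) (r t - r s) (N t)"
  by (rule DERIV_pos_imp_pos[OF _ _ _ DERIV_vol_u_r_N])
    (auto intro!: vol_pos_intros vol_T_T_N_pos vol_T_r_B_pos)

lemma vol_T_r_T_pos: "a \<le> s \<Longrightarrow> s < t \<Longrightarrow> t \<le> b \<Longrightarrow> 0 < vol (T s) (r t - r s) (T t)"
  by (rule DERIV_pos_imp_pos[OF _ _ _ DERIV_vol_u_r_T])
    (auto intro!: vol_pos_intros vol_T_r_N_pos)

lemma vol_r_T_r_pos: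
  assumes "a \<le> s" "s < t" "t < u" "u \<le> b"
  shows "0 < vol (r t - r s) (T t) (r u - r t)"
proof -
  have r_T_N: "0 < vol (r t - r s) (T t) (N u)" if "t < u" "u \<le> b" for u
    by (rule DERIV_pos_imp_pos[OF _ _ _ DERIV_vol_u_v_N])
      (use assms that vol_r_T_N_pos[of s t] in \<open>auto intro!: vol_pos_intros vol_r_T_B_pos\<close>)
  have r_T_T: "0 < vol (r t - r s) (T t) (T u)" if "t < u" "u \<le> b" for u
    by (rule DERIV_pos_imp_pos[OF _ _ _ DERIV_vol_u_v_T])
      (use assms that in \<open>auto intro!: vol_pos_intros r_T_N\<close>)
  show ?thesis
    by (rule DERIV_pos_imp_pos[OF _ _ _ DERIV_vol_u_v_r])
      (use assms in \<open>auto intro!: vol_pos_intros r_T_T\<close>)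
qed

lemma frame_nonzero:
  assumes "a \<le> t" "t \<le> b"
  shows "T t \<noteq> 0" "cross3 (T t) (N t) \<noteq> 0" "cross3 (T t) (N t) \<bullet> B \<noteq> 0"
  using unimodular[OF assms] by (auto simp: vol_def normal_def)

end

section \<open>The associated tetrahedron\<close>

context positive_frame
begin

definition left_leg :: "real \<Rightarrow> real \<Rightarrow> real" where
  "left_leg s t = vol (r t - r s) (T t) (N t) / vol (T s) (T t) (N t)"

definition right_leg :: "real \<Rightarrow> real \<Rightarrow> real" where
  "right_leg s t = vol (T s) (N s) (r t - r s) / vol (T s) (N s) (T t)"

definition left_vertex :: "real \<Rightarrow> real \<Rightarrow> real ^ 3" where
  "left_vertex s t = r s + left_leg s t *\<^sub>R T s"

definition right_vertex :: "real \<Rightarrow> real \<Rightarrow> real ^ 3" where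
  "right_vertex s t = r t - right_leg s t *\<^sub>R T t"

definition tetra :: "real \<Rightarrow> real \<Rightarrow> (real ^ 3) set" where
  "tetra s t = convex hull {r s, left_vertex s t, right_vertex s t, r t}"

lemma left_leg_mult:
  "a \<le> s \<Longrightarrow> s < t \<Longrightarrow> t \<le> b \<Longrightarrow> left_leg s t * vol (T s) (T t) (N t) = vol (r t - r s) (T t) (N t)"
  using vol_T_T_N_pos[of s t] by (simp add: left_leg_def)

lemma right_leg_mult:
  "a \<le> s \<Longrightarrow> s < t \<Longrightarrow> t \<le> b \<Longrightarrow> right_leg s t * vol (T s) (N s) (T t) = vol (T s) (N s) (r t - r s)"
  using vol_T_N_T_pos[of s t] by (simp add: right_leg_def)

lemma legs_pos:
  assumes "a \<le> s" "s < t" "t \<le> b"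
  shows "0 < left_leg s t" "0 < right_leg s t"
  using assms
  by (auto simp: left_leg_def right_leg_def vol_r_T_N_pos vol_T_T_N_pos vol_T_N_r_pos vol_T_N_T_pos)

lemma reverse_legs:
  "positive_frame.left_leg \<kappa> (\<lambda>t. r (- t)) (\<lambda>t. - T (- t)) (\<lambda>t. N (- t)) (- t) (- s) = right_leg s t"
  "positive_frame.right_leg \<kappa> (\<lambda>t. r (- t)) (\<lambda>t. - T (- t)) (\<lambda>t. N (- t)) (- t) (- s) = left_leg s t"
  unfolding positive_frame.left_leg_def[OF reverse] positive_frame.right_leg_def[OF reverse]
    left_leg_def right_leg_def
  by (simp_all add: vol_diff vol_rotate)

lemma reverse_tetra:
  "positive_frame.tetra \<kappa> (\<lambda>t. r (- t)) (\<lambda>t. - T (- t)) (\<lambda>t. N (- t)) (- t) (- s) = tetra s t"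
  unfolding positive_frame.tetra_def[OF reverse] positive_frame.left_vertex_def[OF reverse]
    positive_frame.right_vertex_def[OF reverse] reverse_legs tetra_def left_vertex_def right_vertex_def
  by (simp add: insert_commute)

lemma left_leg_less:
  assumes "a \<le> s" "s < t" "t < u" "u \<le> b"
  shows "left_leg s t < left_leg s u"
  unfolding left_leg_def
proof (rule DERIV_quotient_less[where a = a and b = b])
  show "continuous_on {a..b} (\<lambda>z. vol (r z - r s) (T z) (N z))"
    "continuous_on {a..b} (\<lambda>z. vol (T s) (T z) (N z))"
    by (intro continuous_intros continuous_on_vol continuous)+
  fix z assume "t < z" "z < u"
  then have z: "a < z" "z < b" "s < z" using assms by auto
  show "((\<lambda>z. vol (r z - r s) (T z) (N z)) has_real_derivative \<omega> z * vol (r z - r s) (T z) B) (at z)"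
    "((\<lambda>z. vol (T s) (T z) (N z)) has_real_derivative \<omega> z * vol (T s) (T z) B) (at z)"
    using z by (auto intro: DERIV_vol_r_T_N DERIV_vol_u_T_N)
  have "vol (r z - r s) (T z) B * vol (T s) (T z) (N z)
      - vol (r z - r s) (T z) (N z) * vol (T s) (T z) B = vol (T s) (r z - r s) (T z)"
    using plucker[of "T z" B "r z - r s" "N z" "T s"] unimodular[of z] z
      vol_swap(2)[of "T z" B "N z"] vol_swap(2)[of "T z" "r z - r s" "N z"]
      vol_swap(2)[of "T z" "r z - r s" "T s"]
    by (simp add: vol_rotate)
  then show "0 < \<omega> z * (vol (r z - r s) (T z) B * vol (T s) (T z) (N z)
      - vol (r z - r s) (T z) (N z) * vol (T s) (T z) B)"
    using z assms by (simp add: rates_pos vol_T_r_T_pos)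
next
  show "vol (T s) (T z) (N z) \<noteq> 0" if "t \<le> z" "z \<le> u" for z
    using vol_T_T_N_pos[of s z] assms that by simp
qed (use assms in auto)

lemma right_leg_less:
  assumes "a \<le> s" "s < t" "t < u" "u \<le> b"
  shows "right_leg t u < right_leg s u"
  using positive_frame.left_leg_less[OF reverse, of "- u" "- t" "- s"] assms
  by (simp add: reverse_legs)

lemma right_vertex_decomp:
  assumes "a \<le> s" "s < t" "t \<le> b"
  shows "vol (T s) (N s) (T t) *\<^sub>R (right_vertex s t - r s) =
    vol (T s) (r t - r s) (T t) *\<^sub>R N s - vol (N s) (r t - r s) (T t) *\<^sub>R T s"
proof -
  have "vol (T s) (N s) (T t) *\<^sub>R (right_vertex s t - r s) =
      vol (T s) (N s) (T t) *\<^sub>R (r t - r s) - vol (T s) (N s) (r t - r s) *\<^sub>R T t"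
    unfolding right_leg_mult[OF assms, symmetric] by (simp add: right_vertex_def algebra_simps)
  then show ?thesis
    using cramer[of "T s" "N s" "T t" "r t - r s"] vol_swap(1)[of "N s" "r t - r s" "T t"] by simp
qed

lemma right_vertex_slope_less:
  assumes "a \<le> s" "s < t" "t < u" "u \<le> b"
  shows "vol (N s) (r t - r s) (T t) / vol (T s) (r t - r s) (T t) <
    vol (N s) (r u - r s) (T u) / vol (T s) (r u - r s) (T u)"
proof (rule DERIV_quotient_less[where a = a and b = b])
  show "continuous_on {a..b} (\<lambda>z. vol (N s) (r z - r s) (T z))"
    "continuous_on {a..b} (\<lambda>z. vol (T s) (r z - r s) (T z))"
    by (intro continuous_intros continuous_on_vol continuous)+
  fix z assume "t < z" "z < u"
  then have z: "a < z" "z < b" "s < z" using assms by auto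
  show "((\<lambda>z. vol (N s) (r z - r s) (T z)) has_real_derivative \<sigma> z * vol (N s) (r z - r s) (N z)) (at z)"
    "((\<lambda>z. vol (T s) (r z - r s) (T z)) has_real_derivative \<sigma> z * vol (T s) (r z - r s) (N z)) (at z)"
    using z by (auto intro: DERIV_vol_u_r_T)
  have "vol (N s) (r z - r s) (N z) * vol (T s) (r z - r s) (T z)
      - vol (N s) (r z - r s) (T z) * vol (T s) (r z - r s) (N z)
      = vol (r z - r s) (T z) (N z) * vol (T s) (N s) (r z - r s)"
    using plucker[of "r z - r s" "N z" "N s" "T z" "T s"] vol_swap(2)[of "r z - r s" "N z" "T z"]
      vol_swap(2)[of "r z - r s" "N s" "T z"] vol_swap(2)[of "r z - r s" "N s" "T s"]
    by (simp add: vol_rotate)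
  then show "0 < \<sigma> z * (vol (N s) (r z - r s) (N z) * vol (T s) (r z - r s) (T z)
      - vol (N s) (r z - r s) (T z) * vol (T s) (r z - r s) (N z))"
    using z assms by (simp add: rates_pos vol_r_T_N_pos vol_T_N_r_pos)
next
  show "vol (T s) (r z - r s) (T z) \<noteq> 0" if "t \<le> z" "z \<le> u" for z
    using vol_T_r_T_pos[of s z] assms that by simp
qed (use assms in auto)

abbreviation v1 :: "real ^ 3" where "v1 \<equiv> left_vertex a b"
abbreviation v2 :: "real ^ 3" where "v2 \<equiv> right_vertex a b"
abbreviation chord :: "real ^ 3" where "chord \<equiv> r b - r a"

sublocale tetra: tetrahedron "r a" v1 v2 "r b" "- normal (T b) (N b)" "normal chord (T b)"
  "normal chord (T a)" "normal (T a) (N a)"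
proof unfold_locales
  have sides: "v1 - r a = left_leg a b *\<^sub>R T a" "v2 - r b = - (right_leg a b *\<^sub>R T b)"
    "v2 - r a = chord - right_leg a b *\<^sub>R T b" "v1 - r b = left_leg a b *\<^sub>R T a - chord"
    "r a - r b = - chord"
    by (simp_all add: left_vertex_def right_vertex_def)
  show "0 < - normal (T b) (N b) \<bullet> (r a - r b)" "- normal (T b) (N b) \<bullet> (v1 - r b) = 0"
    "- normal (T b) (N b) \<bullet> (v2 - r b) = 0"
    unfolding sides inner_minus_left vol_def[symmetric]
    using vol_r_T_N_pos[of a b] left_leg_mult[of a b] less vol_rotate(1)[of chord "T b" "N b"]
      vol_rotate(1)[of "T a" "T b" "N b"] by (simp_all add: vol_diff(3))
  show "0 < normal chord (T b) \<bullet> (v1 - r a)" "normal chord (T b) \<bullet> (v2 - r a) = 0"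
    "normal chord (T b) \<bullet> (r b - r a) = 0"
    unfolding sides vol_def[symmetric]
    using vol_T_r_T_pos[of a b] legs_pos[of a b] less vol_rotate(1)[of "T a" chord "T b"]
    by (simp_all add: vol_diff(3))
  show "0 < normal chord (T a) \<bullet> (v2 - r a)" "normal chord (T a) \<bullet> (v1 - r a) = 0"
    "normal chord (T a) \<bullet> (r b - r a) = 0"
    unfolding sides vol_def[symmetric]
    using vol_T_r_T_pos[of a b] legs_pos[of a b] less vol_swap(1)[of "T a" chord "T b"]
    by (simp_all add: vol_diff(3) mult_pos_neg)
  show "0 < normal (T a) (N a) \<bullet> (r b - r a)" "normal (T a) (N a) \<bullet> (v1 - r a) = 0"
    "normal (T a) (N a) \<bullet> (v2 - r a) = 0"
    unfolding sides vol_def[symmetric]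
    using vol_T_N_r_pos[of a b] right_leg_mult[of a b] less by (simp_all add: vol_diff(3))
qed

lemma left_vertex_neq_right_vertex: "left_vertex a b \<noteq> right_vertex a b"
  by (rule tetra.vertices_distinct)

lemma face_heights:
  "- normal (T b) (N b) \<bullet> (X - r b) = vol (r b - X) (T b) (N b)"
  "normal chord (T b) \<bullet> X = vol X chord (T b)"
  "normal chord (T a) \<bullet> X = vol (T a) X chord"
  "normal (T a) (N a) \<bullet> X = vol (T a) (N a) X"
  using vol_rotate(1)[of "r b - X" "T b" "N b"] vol_rotate(1)[of X chord "T b"]
    vol_rotate(2)[of "T a" X chord]
  by (simp_all add: vol_def inner_diff_right)

lemma mem_tetra:
  assumes "0 \<le> vol (T a) (N a) (X - r a)" "0 \<le> vol (T a) (X - r a) chord"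
    "0 \<le> vol (X - r a) chord (T b)" "0 \<le> vol (r b - X) (T b) (N b)"
  shows "X \<in> tetra a b"
  unfolding tetra_def by (rule tetra.mem_convex_hull) (simp_all only: face_heights assms)

lemma vol_T_N_chord_less:
  assumes "a \<le> s" "s < t" "t \<le> b"
  shows "vol (T a) (N t) chord < vol (T a) (N s) chord"
proof (rule DERIV_neg_imp_decreasing_open[OF \<open>s < t\<close>])
  fix z assume "s < z" "z < t"
  then have z: "a < z" "z < b" using assms by auto
  have "\<omega> z * vol (T a) B chord < 0"
    using vol_T_r_B_pos[of a b] vol_swap(2)[of "T a" chord B] \<omega>_pos[OF z] less
    by (simp add: mult_pos_neg)
  then show "\<exists>d. ((\<lambda>t. vol (T a) (N t) chord) has_real_derivative d) (at z) \<and> d < 0"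
    using DERIV_vol_u_N_v[OF z] by blast
qed (use assms in \<open>auto intro!: continuous_on_vol continuous_on_const continuous_on_subset[OF N_cont]\<close>)

text \<open>From its initial value \<open>0\<close> the volume \<open>vol (T a) (T t) chord\<close> first rises and then falls, because its
  rate \<open>vol (T a) (N t) chord\<close> decreases.\<close>

lemma vol_T_T_chord_neg:
  assumes "a < s" "s < t" "t < b" and T_s: "vol (T a) (T s) chord \<le> 0"
  shows "vol (T a) (T t) chord < 0"
proof -
  have N_s: "vol (T a) (N s) chord < 0"
  proof (rule ccontr)
    assume "\<not> vol (T a) (N s) chord < 0"
    then have "0 < vol (T a) (N z) chord" if "a < z" "z < s" for z
      using vol_T_N_chord_less[of z s] that assms by simp
    then have "0 < vol (T a) (T s) chord"
      using assms by (intro DERIV_pos_imp_pos[OF _ order_refl _ DERIV_vol_u_T_v, where b = s])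
        (auto intro!: continuous_on_vol continuous_on_const mult_pos_pos \<sigma>_pos
          intro: continuous_on_subset[OF T_cont])
    then show False using T_s by simp
  qed
  have "vol (T a) (T t) chord < vol (T a) (T s) chord"
  proof (rule DERIV_neg_imp_decreasing_open[OF \<open>s < t\<close>])
    fix z assume "s < z" "z < t"
    then have z: "a < z" "z < b" using assms by auto
    have "\<sigma> z * vol (T a) (N z) chord < 0"
      using N_s vol_T_N_chord_less[of s z] \<sigma>_pos[OF z] \<open>s < z\<close> \<open>a < s\<close> z by (simp add: mult_pos_neg)
    then show "\<exists>d. ((\<lambda>t. vol (T a) (T t) chord) has_real_derivative d) (at z) \<and> d < 0"
      using DERIV_vol_u_T_v[OF z] by blast
  qed (use assms in \<open>auto intro!: continuous_on_vol continuous_on_const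
      intro: continuous_on_subset[OF T_cont]\<close>)
  then show ?thesis using T_s by simp
qed

lemma unimodal_left_face:
  obtains c where "a < c" "c < b" "\<And>t. a < t \<Longrightarrow> t < b \<Longrightarrow> vol (T a) (T t) chord = 0 \<longleftrightarrow> t = c"
    "\<And>t. a \<le> t \<Longrightarrow> t \<le> b \<Longrightarrow> t \<noteq> c \<Longrightarrow> vol (T a) (r t - r a) chord < vol (T a) (r c - r a) chord"
    "\<And>t. a < t \<Longrightarrow> t < b \<Longrightarrow> 0 < vol (T a) (r t - r a) chord"
proof -
  let ?h = "\<lambda>t. vol (T a) (r t - r a) chord" and ?h' = "\<lambda>t. \<rho> t * vol (T a) (T t) chord"
  have sign_change: "?h' t < 0" if "a < s" "s < t" "t < b" "?h' s \<le> 0" for s t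
    using vol_T_T_chord_neg[of s t] that \<rho>_pos[of s] \<rho>_pos[of t]
    by (simp add: mult_le_0_iff mult_pos_neg)
  obtain c where peak: "a < c" "c < b" "\<And>t. a < t \<Longrightarrow> t < b \<Longrightarrow> ?h' t = 0 \<longleftrightarrow> t = c"
    "\<And>t. a \<le> t \<Longrightarrow> t \<le> b \<Longrightarrow> t \<noteq> c \<Longrightarrow> ?h t < ?h c" "\<And>t. a < t \<Longrightarrow> t < b \<Longrightarrow> ?h a < ?h t"
  proof (rule Rolle_unique_max[OF less, of ?h ?h'])
    show "continuous_on {a..b} ?h" by (intro continuous_intros continuous_on_vol continuous)
  qed (auto intro: DERIV_vol_u_r_v sign_change)
  show ?thesis
  proof (rule that[OF peak(1,2)])
    show "vol (T a) (T t) chord = 0 \<longleftrightarrow> t = c" if "a < t" "t < b" for t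
      using peak(3)[OF that] \<rho>_pos[OF that] by simp
  qed (use peak(4,5) in auto)
qed

lemma unimodal_right_face:
  obtains c where "a < c" "c < b" "\<And>t. a < t \<Longrightarrow> t < b \<Longrightarrow> vol (T t) chord (T b) = 0 \<longleftrightarrow> t = c"
    "\<And>t. a \<le> t \<Longrightarrow> t \<le> b \<Longrightarrow> t \<noteq> c \<Longrightarrow> vol (r t - r a) chord (T b) < vol (r c - r a) chord (T b)"
    "\<And>t. a < t \<Longrightarrow> t < b \<Longrightarrow> 0 < vol (r t - r a) chord (T b)"
proof -
  have flip: "vol (- T b) (- T t) (r a - r b) = - vol (T t) chord (T b)"
    "vol (- T b) (r t - r b) (r a - r b) = vol (r t - r a) chord (T b)" for t
    using vol_swap(2)[of "T b" "r b" "r a"] by (simp_all add: vol_diff vol_rotate)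
  obtain c where peak: "- b < c" "c < - a"
    "\<And>t. - b < t \<Longrightarrow> t < - a \<Longrightarrow> vol (T (- t)) chord (T b) = 0 \<longleftrightarrow> t = c"
    "\<And>t. - b \<le> t \<Longrightarrow> t \<le> - a \<Longrightarrow> t \<noteq> c \<Longrightarrow>
      vol (r (- t) - r a) chord (T b) < vol (r (- c) - r a) chord (T b)"
    "\<And>t. - b < t \<Longrightarrow> t < - a \<Longrightarrow> 0 < vol (r (- t) - r a) chord (T b)"
    using positive_frame.unimodal_left_face[OF reverse, unfolded minus_minus flip neg_equal_0_iff_equal]
    by blast
  show ?thesis
  proof (rule that[of "- c"])
    show "vol (T t) chord (T b) = 0 \<longleftrightarrow> t = - c" if "a < t" "t < b" for t
      using peak(3)[of "- t"] that by auto
    show "vol (r t - r a) chord (T b) < vol (r (- c) - r a) chord (T b)"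
      if "a \<le> t" "t \<le> b" "t \<noteq> - c" for t
      using peak(4)[of "- t"] that by (auto simp: minus_equation_iff)
    show "0 < vol (r t - r a) chord (T b)" if "a < t" "t < b" for t using peak(5)[of "- t"] that by simp
  qed (use peak in auto)
qed

lemma left_face_pos: "a < t \<Longrightarrow> t < b \<Longrightarrow> 0 < vol (T a) (r t - r a) chord"
  using unimodal_left_face by blast

lemma right_face_pos: "a < t \<Longrightarrow> t < b \<Longrightarrow> 0 < vol (r t - r a) chord (T b)"
  using unimodal_right_face by blast

lemma curve_mem_tetra:
  assumes "a \<le> t" "t \<le> b"
  shows "r t \<in> tetra a b"
proof -
  consider "t = a" | "t = b" | "a < t" "t < b" using assms by linarith
  then show ?thesis
  proof cases
    case 3
    then show ?thesis
      using left_face_pos[of t] right_face_pos[of t] vol_T_N_r_pos[of a t] vol_r_T_N_pos[of t b]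
      by (intro mem_tetra) auto
  qed (auto simp: tetra_def hull_inc)
qed

lemma left_vertex_mem_tetra:
  assumes "a < c" "c < b"
  shows "left_vertex a c \<in> tetra a b"
proof (rule mem_tetra)
  have side: "left_vertex a c - r a = left_leg a c *\<^sub>R T a" by (simp add: left_vertex_def)
  have leg: "0 < left_leg a c" using legs_pos assms by simp
  show "0 \<le> vol (T a) (N a) (left_vertex a c - r a)" "0 \<le> vol (T a) (left_vertex a c - r a) chord"
    unfolding side by simp_all
  show "0 \<le> vol (left_vertex a c - r a) chord (T b)"
    unfolding side using leg vol_T_r_T_pos[of a b] less by simp
  have "vol (r b - left_vertex a c) (T b) (N b) =
      vol chord (T b) (N b) - left_leg a c * vol (T a) (T b) (N b)"
    by (simp add: left_vertex_def vol_diff vol_add)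
  also have "\<dots> = (left_leg a b - left_leg a c) * vol (T a) (T b) (N b)"
    using left_leg_mult[of a b] less by (simp add: left_diff_distrib)
  also have "0 \<le> \<dots>"
    using left_leg_less[of a c b] vol_T_T_N_pos[of a b] assms by simp
  finally show "0 \<le> vol (r b - left_vertex a c) (T b) (N b)" .
qed

lemma right_vertex_mem_tetra:
  assumes "a < c" "c < b"
  shows "right_vertex a c \<in> tetra a b"
proof (rule mem_tetra)
  let ?d = "vol (T a) (N a) (T c)" and ?X = "right_vertex a c - r a"
    and ?T = "\<lambda>t. vol (T a) (r t - r a) (T t)" and ?N = "\<lambda>t. vol (N a) (r t - r a) (T t)"
  have T_pos: "0 < ?T c" "0 < ?T b" using vol_T_r_T_pos assms by auto
  have decomp: "?d *\<^sub>R ?X = ?T c *\<^sub>R N a - ?N c *\<^sub>R T a" using right_vertex_decomp[of a c] assms by simp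
  have "0 < ?d" using vol_T_N_T_pos assms by simp
  then have scale: "0 \<le> h" if "0 \<le> ?d * h" for h using that by (simp add: zero_le_mult_iff)
  have "?d * vol (T a) (N a) ?X = 0"
    unfolding vol_scaleR(3)[symmetric] decomp by (simp add: vol_diff)
  then show "0 \<le> vol (T a) (N a) ?X" using \<open>0 < ?d\<close> by simp
  have "?d * vol (T a) ?X chord = ?T c * vol (T a) (N a) chord"
    unfolding vol_scaleR(2)[symmetric] decomp by (simp add: vol_diff)
  then show "0 \<le> vol (T a) ?X chord"
    using scale[of "vol (T a) ?X chord"] T_pos vol_T_N_r_pos[of a b] less by simp
  have "?d * vol ?X chord (T b) = ?T c * ?N b - ?N c * ?T b"
    unfolding vol_scaleR(1)[symmetric] decomp by (simp add: vol_diff)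
  moreover have "?N c / ?T c < ?N b / ?T b" using right_vertex_slope_less[of a c b] assms by simp
  then have "?N c * ?T b < ?T c * ?N b" using T_pos by (simp add: field_simps)
  ultimately show "0 \<le> vol ?X chord (T b)" using scale[of "vol ?X chord (T b)"] by simp
  have "vol (r b - right_vertex a c) (T b) (N b) =
      vol (r b - r c) (T b) (N b) + right_leg a c * vol (T c) (T b) (N b)"
    by (simp add: right_vertex_def vol_diff)
  then show "0 \<le> vol (r b - right_vertex a c) (T b) (N b)"
    using vol_r_T_N_pos[of c b] vol_T_T_N_pos[of c b] legs_pos[of a c] assms by simp
qed

lemma tetra_subset_right:
  assumes "a < c" "c \<le> b"
  shows "tetra a c \<subseteq> tetra a b"
proof (cases "c = b")
  case False
  then have "{r a, left_vertex a c, right_vertex a c, r c} \<subseteq> tetra a b"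
    using assms curve_mem_tetra left_vertex_mem_tetra right_vertex_mem_tetra by auto
  then show ?thesis unfolding tetra_def[of a c] by (rule hull_minimal) (simp add: tetra_def)
qed simp

lemma tetra_subset_left:
  assumes "a \<le> c" "c < b"
  shows "tetra c b \<subseteq> tetra a b"
  using positive_frame.tetra_subset_right[OF reverse, of "- c"] assms by (simp add: reverse_tetra)

lemma tetra_subset:
  assumes "a \<le> s" "s < t" "t \<le> b"
  shows "tetra s t \<subseteq> tetra a b"
proof -
  have "positive_frame \<kappa> a t r T N B \<rho> \<sigma> \<omega>" using assms by (intro subframe) auto
  then have "tetra s t \<subseteq> tetra a t" using assms by (intro positive_frame.tetra_subset_left)
  also have "\<dots> \<subseteq> tetra a b" using assms by (intro tetra_subset_right) auto
  finally show ?thesis .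
qed

end

section \<open>Planes moving along the curve\<close>

context positive_frame
begin

definition osculating_plane :: "real \<Rightarrow> (real ^ 3) set" where
  "osculating_plane t = {X. vol (T t) (N t) (X - r t) = 0}"

lemma osculating_plane_eq:
  "osculating_plane t = {X. (X - r t) \<bullet> cross3 (T t) (N t) = 0}" if "a \<le> t" "t \<le> b"
proof -
  have "\<kappa> \<noteq> 0" using unimodular[OF that] by (auto simp: vol_def normal_def)
  then show ?thesis by (simp add: osculating_plane_def vol_def normal_def inner_commute)
qed

lemma tangents_Int_osculating_planes:
  assumes "a \<le> s" "s < t" "t \<le> b"
  shows "{r s + c *\<^sub>R T s | c. True} \<inter> (osculating_plane s \<inter> osculating_plane t) = {left_vertex s t}"
    and "{r t + c *\<^sub>R T t | c. True} \<inter> (osculating_plane s \<inter> osculating_plane t) = {right_vertex s t}"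
proof -
  have line: "{u + c *\<^sub>R v | c. True} \<inter> E = {u + k *\<^sub>R v}" if "\<And>c. u + c *\<^sub>R v \<in> E \<longleftrightarrow> c = k"
    for u v :: "real ^ 3" and E k
    using that by auto
  have pos: "0 < vol (T s) (T t) (N t)" "0 < vol (T s) (N s) (T t)"
    using vol_T_T_N_pos vol_T_N_T_pos assms by auto
  have "vol (T t) (N t) (r s + c *\<^sub>R T s - r t) = (c - left_leg s t) * vol (T s) (T t) (N t)" for c
    using left_leg_mult[OF assms] vol_rotate(1)[of "T s" "T t"] vol_rotate(1)[of "r t" "T t"]
      vol_rotate(1)[of "r s" "T t"] by (simp add: vol_add vol_diff algebra_simps)
  then have "r s + c *\<^sub>R T s \<in> osculating_plane s \<inter> osculating_plane t \<longleftrightarrow> c = left_leg s t" for c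
    using pos by (simp add: osculating_plane_def)
  then show "{r s + c *\<^sub>R T s | c. True} \<inter> (osculating_plane s \<inter> osculating_plane t) = {left_vertex s t}"
    unfolding left_vertex_def by (rule line)
  have "vol (T s) (N s) (r t + c *\<^sub>R T t - r s) = (c + right_leg s t) * vol (T s) (N s) (T t)" for c
    using right_leg_mult[OF assms] by (simp add: vol_add vol_diff algebra_simps)
  then have "r t + c *\<^sub>R T t \<in> osculating_plane s \<inter> osculating_plane t \<longleftrightarrow> c = - right_leg s t" for c
    using pos by (simp add: osculating_plane_def add_eq_0_iff2)
  then have "{r t + c *\<^sub>R T t | c. True} \<inter> (osculating_plane s \<inter> osculating_plane t) =
      {r t + (- right_leg s t) *\<^sub>R T t}"
    by (rule line)
  then show "{r t + c *\<^sub>R T t | c. True} \<inter> (osculating_plane s \<inter> osculating_plane t) = {right_vertex s t}"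
    by (simp add: right_vertex_def)
qed

lemma osculating_quotient_less:
  assumes "a < s" "s < t" "t < b"
    and nonzero: "\<And>z. s \<le> z \<Longrightarrow> z \<le> t \<Longrightarrow> vol (T z) (N z) (v - r z) \<noteq> 0"
    and side: "\<And>z. s < z \<Longrightarrow> z < t \<Longrightarrow> 0 < vol (T z) (u - r z) (v - r z)"
  shows "vol (T t) (N t) (u - r t) / vol (T t) (N t) (v - r t) <
    vol (T s) (N s) (u - r s) / vol (T s) (N s) (v - r s)"
proof -
  have "- vol (T s) (N s) (u - r s) / vol (T s) (N s) (v - r s) <
    - vol (T t) (N t) (u - r t) / vol (T t) (N t) (v - r t)"
  proof (rule DERIV_quotient_less[where a = a and b = b])
    show "continuous_on {a..b} (\<lambda>z. - vol (T z) (N z) (u - r z))"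
      "continuous_on {a..b} (\<lambda>z. vol (T z) (N z) (v - r z))"
      by (intro continuous_intros continuous_on_vol continuous)+
    fix z assume "s < z" "z < t"
    then have z: "a < z" "z < b" "0 < vol (T z) (u - r z) (v - r z)" using assms by auto
    show "((\<lambda>z. - vol (T z) (N z) (u - r z)) has_real_derivative \<omega> z * - vol (T z) B (u - r z)) (at z)"
      "((\<lambda>z. vol (T z) (N z) (v - r z)) has_real_derivative \<omega> z * vol (T z) B (v - r z)) (at z)"
      using z DERIV_minus[OF DERIV_vol_T_N_minus_r] DERIV_vol_T_N_minus_r by auto
    have "- vol (T z) B (u - r z) * vol (T z) (N z) (v - r z)
        - - vol (T z) (N z) (u - r z) * vol (T z) B (v - r z) = vol (T z) (u - r z) (v - r z)"
      using plucker[of "T z" B "u - r z" "N z" "v - r z"] unimodular[of z] z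
        vol_swap(2)[of "T z" B "N z"] vol_swap(2)[of "T z" "u - r z" "N z"] by simp
    then show "0 < \<omega> z * (- vol (T z) B (u - r z) * vol (T z) (N z) (v - r z)
        - - vol (T z) (N z) (u - r z) * vol (T z) B (v - r z))"
      using z rates_pos by simp
  qed (use assms in auto)
  then show ?thesis by simp
qed

lemma osculating_plane_Int_edge:
  assumes opposite: "\<And>t. a < t \<Longrightarrow> t < b \<Longrightarrow> vol (T t) (N t) (u - r t) * vol (T t) (N t) (v - r t) < 0"
    and side: "\<And>t. a < t \<Longrightarrow> t < b \<Longrightarrow> 0 < vol (T t) (u - r t) (v - r t)"
  obtains p where "\<And>t. a < t \<Longrightarrow> t < b \<Longrightarrow> osculating_plane t \<inter> affine hull {u, v} = {p t}"
    "strictly_monotone_on {a<..<b} (\<lambda>t. dist u (p t))"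
proof -
  have decreasing: "vol (T t) (N t) (u - r t) / vol (T t) (N t) (v - r t) <
      vol (T s) (N s) (u - r s) / vol (T s) (N s) (v - r s)"
    if "s \<in> {a<..<b}" "t \<in> {a<..<b}" "s < t" for s t
  proof (rule osculating_quotient_less)
    show "vol (T z) (N z) (v - r z) \<noteq> 0" if "s \<le> z" "z \<le> t" for z
      using opposite[of z] that \<open>s \<in> {a<..<b}\<close> \<open>t \<in> {a<..<b}\<close> by auto
  qed (use that side in auto)
  obtain p where "\<And>t. t \<in> {a<..<b} \<Longrightarrow> osculating_plane t \<inter> affine hull {u, v} = {p t}"
    "strictly_monotone_on {a<..<b} (\<lambda>t. dist u (p t))"
    using moving_plane_Int_edge[of "{a<..<b}" "\<lambda>t. normal (T t) (N t)" u r v, folded vol_def,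
        OF _ decreasing] opposite unfolding osculating_plane_def by auto
  then show ?thesis using that by auto
qed

lemma osculating_signs:
  assumes "a < t" "t < b"
  shows "vol (T t) (N t) (r a - r t) < 0" "0 < vol (T t) (N t) (v1 - r t)"
    "vol (T t) (N t) (v2 - r t) < 0" "0 < vol (T t) (N t) (r b - r t)"
proof -
  have left: "vol (T t) (N t) (r a - r t) = - (left_leg a t * vol (T a) (T t) (N t))"
    using left_leg_mult[of a t] vol_rotate(1)[of "r t - r a" "T t" "N t"] assms by (simp add: vol_diff)
  have right: "vol (T t) (N t) (r b - r t) = right_leg t b * vol (T t) (N t) (T b)"
    using right_leg_mult[of t b] assms by simp
  have "vol (T t) (N t) (v1 - r t) =
      vol (T t) (N t) (r a - r t) + left_leg a b * vol (T t) (N t) (T a)"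
    by (simp add: left_vertex_def vol_add vol_diff)
  also have "\<dots> = (left_leg a b - left_leg a t) * vol (T a) (T t) (N t)"
    unfolding left by (simp add: algebra_simps vol_rotate(1)[of "T a"])
  also have "0 < \<dots>" using left_leg_less[of a t b] vol_T_T_N_pos[of a t] assms by simp
  finally show "0 < vol (T t) (N t) (v1 - r t)" .
  have "vol (T t) (N t) (v2 - r t) =
      vol (T t) (N t) (r b - r t) - right_leg a b * vol (T t) (N t) (T b)"
    by (simp add: right_vertex_def vol_diff)
  also have "\<dots> = (right_leg t b - right_leg a b) * vol (T t) (N t) (T b)"
    unfolding right by (simp add: algebra_simps)
  also have "\<dots> < 0"
    using right_leg_less[of a t b] vol_T_N_T_pos[of t b] assms by (simp add: mult_neg_pos)
  finally show "vol (T t) (N t) (v2 - r t) < 0" .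
  show "vol (T t) (N t) (r a - r t) < 0" "0 < vol (T t) (N t) (r b - r t)"
    unfolding left right using legs_pos vol_T_T_N_pos[of a t] vol_T_N_T_pos[of t b] assms by auto
qed

lemma tangent_side_left:
  assumes "a < t" "t < b"
  shows "0 < vol (T t) (r a - r t) (v1 - r t)"
proof -
  have "vol (T t) (r a - r t) (v1 - r t) = left_leg a b * vol (T a) (r t - r a) (T t)"
    using vol_swap(1)[of "T t" "r t" "T a"] vol_swap(1)[of "T t" "r a" "T a"]
      vol_swap(2)[of "T t" "r a" "r t"]
    by (simp add: left_vertex_def vol_diff vol_add vol_rotate algebra_simps)
  then show ?thesis using legs_pos vol_T_r_T_pos assms by simp
qed

lemma tangent_side_right:
  assumes "a < t" "t < b"
  shows "0 < vol (T t) (v2 - r t) (r b - r t)"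
proof -
  have "vol (T t) (v2 - r t) (r b - r t) = right_leg a b * vol (T t) (r b - r t) (T b)"
    using vol_swap(2)[of "T t" "T b" "r b"] vol_swap(2)[of "T t" "T b" "r t"]
      vol_swap(2)[of "T t" "r b" "r t"]
    by (simp add: right_vertex_def vol_diff vol_add algebra_simps)
  then show ?thesis using legs_pos vol_T_r_T_pos assms by simp
qed

lemma tangent_side_middle:
  assumes "a < t" "t < b"
  shows "0 < vol (T t) (v1 - r t) (v2 - r t)"
proof -
  let ?w = "v2 - v1"
  have faces: "vol (T a) (N a) (v1 - r a) = 0" "vol (T a) (N a) (v2 - r a) = 0"
    "vol (T b) (N b) (v1 - r b) = 0" "vol (T b) (N b) (v2 - r b) = 0"
    using tetra.face0 tetra.face3 by (simp_all add: vol_def)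
  have base: "vol (T a) ?w (T b) = vol (T a) chord (T b)"
    by (simp add: left_vertex_def right_vertex_def vol_add vol_diff)
  have side: "vol (T t) (v1 - r t) (v2 - r t) = vol (T t) (v1 - r t) ?w"
    by (simp add: vol_diff vol_swap(2)[of "T t" "r t"])
  have "vol (T b) (N b) (v1 - r t) = vol (T b) (N b) (r b - r t)"
    "vol (T a) (N a) (v1 - r t) = - vol (T a) (N a) (r t - r a)"
    using faces by (simp_all add: vol_diff)
  moreover have "vol (T t) (v1 - r t) ?w * (vol (T a) (N a) (T b) * vol (T b) (N b) (T a)) =
      vol (T a) ?w (T b) * (vol (T a) (N a) (T t) * vol (T b) (N b) (v1 - r t)
        - vol (T b) (N b) (T t) * vol (T a) (N a) (v1 - r t))"
    by (rule vol_line_of_planes)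
      (use faces vol_T_r_T_pos[of a b] less in \<open>simp_all add: vol_diff base[unfolded vol_diff]\<close>)
  ultimately have "vol (T t) (v1 - r t) (v2 - r t) * (vol (T a) (N a) (T b) * vol (T a) (T b) (N b)) =
      vol (T a) chord (T b) * (vol (T a) (N a) (T t) * vol (r b - r t) (T b) (N b)
        + vol (T t) (T b) (N b) * vol (T a) (N a) (r t - r a))"
    unfolding side base vol_rotate(1)[of "T t" "T b"] vol_rotate(1)[of "T a" "T b"]
      vol_rotate(1)[of "r b - r t"] by simp
  also have "0 < \<dots>"
    using assms
    by (intro mult_pos_pos add_pos_pos vol_T_r_T_pos vol_T_N_T_pos vol_r_T_N_pos vol_T_T_N_pos
        vol_T_N_r_pos) auto
  finally show ?thesis
    by (rule zero_less_mult_pos2) (use vol_T_N_T_pos[of a b] vol_T_T_N_pos[of a b] less in simp)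
qed

lemma osculating_plane_Int_edges:
  "\<exists>p01 p12 p23. (\<forall>t. a < t \<and> t < b \<longrightarrow> osculating_plane t \<inter> affine hull {r a, v1} = {p01 t} \<and>
      osculating_plane t \<inter> affine hull {v1, v2} = {p12 t} \<and>
      osculating_plane t \<inter> affine hull {v2, r b} = {p23 t}) \<and>
    strictly_monotone_on {a<..<b} (\<lambda>t. dist (r a) (p01 t)) \<and>
    strictly_monotone_on {a<..<b} (\<lambda>t. dist v1 (p12 t)) \<and>
    strictly_monotone_on {a<..<b} (\<lambda>t. dist v2 (p23 t))"
  by (rule osculating_plane_Int_edge[OF mult_neg_pos[OF osculating_signs(1,2)] tangent_side_left],
      assumption+,
      rule osculating_plane_Int_edge[OF mult_pos_neg[OF osculating_signs(2,3)] tangent_side_middle],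
      assumption+,
      rule osculating_plane_Int_edge[OF mult_neg_pos[OF osculating_signs(3,4)] tangent_side_right],
      assumption+) blast

lemma osculating_heights_quotient_less:
  assumes "a < s" "s < t" "t < b"
  shows "vol (T a) (N a) (r s - r a) / vol (r b - r s) (T b) (N b)
    < vol (T a) (N a) (r t - r a) / vol (r b - r t) (T b) (N b)"
proof (rule DERIV_quotient_less[where a = a and b = b])
  show "continuous_on {a..b} (\<lambda>z. vol (T a) (N a) (r z - r a))"
    "continuous_on {a..b} (\<lambda>z. vol (r b - r z) (T b) (N b))"
    by (intro continuous_intros continuous_on_vol continuous)+
  fix z assume "s < z" "z < t"
  then have z: "a < z" "z < b" using assms by auto
  show "((\<lambda>z. vol (T a) (N a) (r z - r a)) has_real_derivative \<rho> z * vol (T a) (N a) (T z)) (at z)"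
    "((\<lambda>z. vol (r b - r z) (T b) (N b)) has_real_derivative \<rho> z * - vol (T z) (T b) (N b)) (at z)"
    using DERIV_vol_u_v_r[OF z] DERIV_vol_minus_r_u_v[OF z] by simp_all
  show "0 < \<rho> z * (vol (T a) (N a) (T z) * vol (r b - r z) (T b) (N b)
      - vol (T a) (N a) (r z - r a) * - vol (T z) (T b) (N b))"
    using z \<rho>_pos[of z] vol_T_N_T_pos[of a z] vol_r_T_N_pos[of z b] vol_T_N_r_pos[of a z]
      vol_T_T_N_pos[of z b]
    by (simp add: add_pos_pos)
next
  show "vol (r b - r z) (T b) (N b) \<noteq> 0" if "s \<le> z" "z \<le> t" for z
    using vol_r_T_N_pos[of z b] assms that by simp
qed (use assms in auto)

lemma plane_through_middle_edge_Int_chord: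
  obtains p where "\<And>t. a < t \<Longrightarrow> t < b \<Longrightarrow> \<not> collinear {v1, v2, r t}"
    "\<And>t. a < t \<Longrightarrow> t < b \<Longrightarrow> affine hull {v1, v2, r t} \<inter> affine hull {r a, r b} = {p t}"
    "strictly_monotone_on {a<..<b} (\<lambda>t. dist (r a) (p t))"
proof -
  let ?n = "normal (T a) (N a)" and ?m = "- normal (T b) (N b)"
  have "?n \<bullet> (r t - v1) = ?n \<bullet> (r t - r a)" "?m \<bullet> (r t - v1) = ?m \<bullet> (r t - r b)" for t
    using tetra.face3(2) tetra.face0(2) by (simp_all add: inner_diff_right)
  then have heights: "?n \<bullet> (r t - v1) = vol (T a) (N a) (r t - r a)"
    "?m \<bullet> (r t - v1) = vol (r b - r t) (T b) (N b)" for t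
    by (simp_all only: face_heights)
  show ?thesis
  proof (rule pencil_plane_Int_opposite_edge[of v1 v2 ?n ?m "r a" "r b" "{a<..<b}" r])
    show "0 < ?n \<bullet> (r t - v1) \<and> 0 < ?m \<bullet> (r t - v1)" if "t \<in> {a<..<b}" for t
      unfolding heights using that vol_T_N_r_pos[of a t] vol_r_T_N_pos[of t b] by simp
    show "?n \<bullet> (r s - v1) / (?m \<bullet> (r s - v1)) < ?n \<bullet> (r t - v1) / (?m \<bullet> (r t - v1))"
      if "s \<in> {a<..<b}" "t \<in> {a<..<b}" "s < t" for s t
      unfolding heights using osculating_heights_quotient_less[of s t] that by simp
  qed (use tetra.vertices_distinct tetra.face0 tetra.face3 that in \<open>auto simp: inner_diff_right\<close>)
qed

lemma chord_faces_quotient_less: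
  assumes "a < s" "s < t" "t < b"
  shows "vol (T a) (r s - r a) chord / vol (r s - r a) chord (T b)
    < vol (T a) (r t - r a) chord / vol (r t - r a) chord (T b)"
proof (rule DERIV_quotient_less[where a = a and b = b])
  show "continuous_on {a..b} (\<lambda>z. vol (T a) (r z - r a) chord)"
    "continuous_on {a..b} (\<lambda>z. vol (r z - r a) chord (T b))"
    by (intro continuous_intros continuous_on_vol continuous)+
  fix z assume "s < z" "z < t"
  then have z: "a < z" "z < b" using assms by auto
  show "((\<lambda>z. vol (T a) (r z - r a) chord) has_real_derivative \<rho> z * vol (T a) (T z) chord) (at z)"
    "((\<lambda>z. vol (r z - r a) chord (T b)) has_real_derivative \<rho> z * vol (T z) chord (T b)) (at z)"
    using DERIV_vol_u_r_v[OF z] DERIV_vol_r_u_v[OF z] .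
  let ?R = "r z - r a"
  have "vol (T a) (T z) chord * vol ?R chord (T b) - vol (T a) ?R chord * vol (T z) chord (T b)
      = vol (T a) chord (T b) * vol ?R (T z) chord"
    using plucker[of chord "T a" "T z" "T b" ?R] vol_swap(1)[of "T a" chord "T b"]
      vol_swap(2)[of ?R "T z" chord] vol_swap(1)[of "T z" chord "T b"]
    unfolding vol_rotate(2)[of "T a" "T z" chord] vol_rotate(2)[of "T a" ?R chord]
      vol_rotate(1)[of ?R chord]
    by (simp add: algebra_simps)
  moreover have "vol ?R (T z) chord = vol ?R (T z) (r b - r z)"
    using vol_swap(2)[of "T z" "r a" "r z"] by (simp add: vol_diff vol_rotate)
  ultimately show "0 < \<rho> z * (vol (T a) (T z) chord * vol ?R chord (T b)
      - vol (T a) ?R chord * vol (T z) chord (T b))"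
    using z \<rho>_pos[of z] vol_T_r_T_pos[of a b] vol_r_T_r_pos[of a z b] by simp
next
  show "vol (r z - r a) chord (T b) \<noteq> 0" if "s \<le> z" "z \<le> t" for z
    using right_face_pos[of z] assms that by simp
qed (use assms in auto)

lemma plane_through_chord_Int_middle_edge:
  obtains p where "\<And>t. a < t \<Longrightarrow> t < b \<Longrightarrow> \<not> collinear {r a, r b, r t}"
    "\<And>t. a < t \<Longrightarrow> t < b \<Longrightarrow> affine hull {r a, r b, r t} \<inter> affine hull {v1, v2} = {p t}"
    "strictly_monotone_on {a<..<b} (\<lambda>t. dist v1 (p t))"
proof -
  let ?n = "normal chord (T a)" and ?m = "normal chord (T b)"
  show ?thesis
  proof (rule pencil_plane_Int_opposite_edge[of "r a" "r b" ?n ?m v1 v2 "{a<..<b}" r])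
    show "0 < ?n \<bullet> (r t - r a) \<and> 0 < ?m \<bullet> (r t - r a)" if "t \<in> {a<..<b}" for t
      unfolding face_heights using that left_face_pos right_face_pos by simp
    show "?n \<bullet> (r s - r a) / (?m \<bullet> (r s - r a)) < ?n \<bullet> (r t - r a) / (?m \<bullet> (r t - r a))"
      if "s \<in> {a<..<b}" "t \<in> {a<..<b}" "s < t" for s t
      unfolding face_heights using chord_faces_quotient_less[of s t] that by simp
  qed (use tetra.vertices_distinct tetra.face1 tetra.face2 that in auto)
qed

lemma planes_through_opposite_edges:
  "\<exists>p03 q12. (\<forall>t. a < t \<and> t < b \<longrightarrow> \<not> collinear {v1, v2, r t} \<and> \<not> collinear {r a, r b, r t} \<and>
      affine hull {v1, v2, r t} \<inter> affine hull {r a, r b} = {p03 t} \<and>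
      affine hull {r a, r b, r t} \<inter> affine hull {v1, v2} = {q12 t}) \<and>
    strictly_monotone_on {a<..<b} (\<lambda>t. dist (r a) (p03 t)) \<and>
    strictly_monotone_on {a<..<b} (\<lambda>t. dist v1 (q12 t))"
  by (rule plane_through_middle_edge_Int_chord, rule plane_through_chord_Int_middle_edge) blast

end

section \<open>Quasi-cubic segments\<close>

context positive_frame
begin

lemma d1_eq: "a < t \<Longrightarrow> t < b \<Longrightarrow> d1 r t = \<rho> t *\<^sub>R T t"
  unfolding d1_def by (rule vector_derivative_at[OF r_deriv])

lemma parallel_points_plane:
  assumes "c \<in> {a<..<b}" "\<And>t. a < t \<Longrightarrow> t < b \<Longrightarrow> n \<bullet> T t = 0 \<longleftrightarrow> t = c"
  shows "parallel_points r a b {X. n \<bullet> (X - e) = 0} = {r c}"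
proof -
  have "parallel_to_plane (d1 r t) {X. n \<bullet> (X - e) = 0} \<longleftrightarrow> t = c" if "a < t" "t < b" for t
    using assms(2)[OF that] \<rho>_pos[OF that] by (simp add: parallel_to_plane_iff d1_eq[OF that])
  then show ?thesis using assms(1) unfolding parallel_points_def by auto
qed

lemma parallel_farthest_left_face:
  "\<exists>p. parallel_points r a b (affine hull {r a, v1, r b}) = {p} \<and>
    farthest_points r a b (affine hull {r a, v1, r b}) = {p}"
proof -
  obtain c where peak: "a < c" "c < b" "\<And>t. a < t \<Longrightarrow> t < b \<Longrightarrow> vol (T a) (T t) chord = 0 \<longleftrightarrow> t = c"
    "\<And>t. a \<le> t \<Longrightarrow> t \<le> b \<Longrightarrow> t \<noteq> c \<Longrightarrow> vol (T a) (r t - r a) chord < vol (T a) (r c - r a) chord"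
    "\<And>t. a < t \<Longrightarrow> t < b \<Longrightarrow> 0 < vol (T a) (r t - r a) chord"
    by (rule unimodal_left_face) (rule that)
  have "0 \<le> vol (T a) (r t - r a) chord" if "a \<le> t" "t \<le> b" for t
    using peak(5)[of t] that by (cases "t = a"; cases "t = b") auto
  moreover have "normal chord (T a) \<noteq> 0" using tetra.face2(1) by auto
  ultimately show ?thesis
    unfolding tetra.affine_hull_faces(3) using peak
    by (intro exI[of _ "r c"] conjI parallel_points_plane farthest_points_plane)
      (auto simp: face_heights)
qed

lemma parallel_farthest_right_face:
  "\<exists>p. parallel_points r a b (affine hull {r a, v2, r b}) = {p} \<and>
    farthest_points r a b (affine hull {r a, v2, r b}) = {p}"
proof -
  obtain c where peak: "a < c" "c < b" "\<And>t. a < t \<Longrightarrow> t < b \<Longrightarrow> vol (T t) chord (T b) = 0 \<longleftrightarrow> t = c"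
    "\<And>t. a \<le> t \<Longrightarrow> t \<le> b \<Longrightarrow> t \<noteq> c \<Longrightarrow> vol (r t - r a) chord (T b) < vol (r c - r a) chord (T b)"
    "\<And>t. a < t \<Longrightarrow> t < b \<Longrightarrow> 0 < vol (r t - r a) chord (T b)"
    by (rule unimodal_right_face) (rule that)
  have "0 \<le> vol (r t - r a) chord (T b)" if "a \<le> t" "t \<le> b" for t
    using peak(5)[of t] that by (cases "t = a"; cases "t = b") auto
  moreover have "normal chord (T b) \<noteq> 0" using tetra.face1(1) by auto
  ultimately show ?thesis
    unfolding tetra.affine_hull_faces(2) using peak
    by (intro exI[of _ "r c"] conjI parallel_points_plane farthest_points_plane)
      (auto simp: face_heights)
qed

lemma unit_tangent_eq: "a < t \<Longrightarrow> t < b \<Longrightarrow> unit_tangent r t = sgn (T t)"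
  using \<rho>_pos[of t] by (simp add: unit_tangent_def d1_eq sgn_div_norm divide_inverse)

lemma continuous_sgn_frame:
  "continuous_on {a..b} (\<lambda>t. sgn (T t))" "continuous_on {a..b} (\<lambda>t. sgn (cross3 (T t) (N t)))"
  using frame_nonzero by (auto intro!: continuous_on_sgn continuous_on_cross continuous)

lemma tangent_eq:
  "a \<le> s \<Longrightarrow> s < b \<Longrightarrow> tangent_plus r s = sgn (T s)" "a < s \<Longrightarrow> s \<le> b \<Longrightarrow> tangent_minus r s = sgn (T s)"
  unfolding tangent_plus_def tangent_minus_def
  by (rule Lim_at_right_continuous_on[OF continuous_sgn_frame(1)]
      Lim_at_left_continuous_on[OF continuous_sgn_frame(1)]; simp add: unit_tangent_eq)+

lemma tline_eq:
  "a \<le> s \<Longrightarrow> s < b \<Longrightarrow> tline_plus r s = {r s + c *\<^sub>R T s | c. True}"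
  "a < s \<Longrightarrow> s \<le> b \<Longrightarrow> tline_minus r s = {r s + c *\<^sub>R T s | c. True}"
  unfolding tline_plus_def tline_minus_def by (simp_all only: tangent_eq line_sgn)

lemma parallel_tangents:
  "parallel_vec (tangent_plus r a) (v1 - r a)" "parallel_vec (tangent_minus r b) (r b - v2)"
proof -
  have "v1 - r a = left_leg a b *\<^sub>R T a" "r b - v2 = right_leg a b *\<^sub>R T b"
    by (simp_all add: left_vertex_def right_vertex_def)
  then show "parallel_vec (tangent_plus r a) (v1 - r a)" "parallel_vec (tangent_minus r b) (r b - v2)"
    using less legs_pos[of a b] frame_nonzero(1)[of a] frame_nonzero(1)[of b]
    by (simp_all add: parallel_vec_def tangent_eq sgn_div_norm cross_mult_left cross_mult_right)
qed

end

locale smooth_positive_frame = positive_frame \<kappa> a b r T N B \<rho> \<sigma> \<omega>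
  for \<kappa> a b r T N B \<rho> \<sigma> \<omega> +
  fixes \<rho>' \<rho>'' \<sigma>' :: "real \<Rightarrow> real"
  assumes rates_deriv: "\<And>t. a < t \<Longrightarrow> t < b \<Longrightarrow> (\<rho> has_real_derivative \<rho>' t) (at t)"
      "\<And>t. a < t \<Longrightarrow> t < b \<Longrightarrow> (\<rho>' has_real_derivative \<rho>'' t) (at t)"
      "\<And>t. a < t \<Longrightarrow> t < b \<Longrightarrow> (\<sigma> has_real_derivative \<sigma>' t) (at t)"
begin

lemma d2_eq:
  assumes t: "a < t" "t < b"
  shows "d2 r t = \<rho>' t *\<^sub>R T t + (\<rho> t * \<sigma> t) *\<^sub>R N t"
  unfolding d2_def
proof (rule vector_derivative_eq_on_interval[OF _ t d1_eq])
  show "((\<lambda>t. \<rho> t *\<^sub>R T t) has_vector_derivative \<rho>' t *\<^sub>R T t + (\<rho> t * \<sigma> t) *\<^sub>R N t) (at t)"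
    by (auto intro!: derivative_eq_intros frenet rates_deriv t)
qed

lemma d3_eq:
  assumes t: "a < t" "t < b"
  shows "d3 r t = \<rho>'' t *\<^sub>R T t + (\<rho>' t * \<sigma> t + (\<rho>' t * \<sigma> t + \<rho> t * \<sigma>' t)) *\<^sub>R N t
    + (\<rho> t * \<sigma> t * \<omega> t) *\<^sub>R B"
  unfolding d3_def
proof (rule vector_derivative_eq_on_interval[OF _ t d2_eq])
  show "((\<lambda>t. \<rho>' t *\<^sub>R T t + (\<rho> t * \<sigma> t) *\<^sub>R N t) has_vector_derivative
      \<rho>'' t *\<^sub>R T t + (\<rho>' t * \<sigma> t + (\<rho>' t * \<sigma> t + \<rho> t * \<sigma>' t)) *\<^sub>R N t + (\<rho> t * \<sigma> t * \<omega> t) *\<^sub>R B) (at t)"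
    by (auto intro!: derivative_eq_intros frenet rates_deriv t simp: vec_eq_iff algebra_simps)
qed

lemma cross_d1_d2:
  "a < t \<Longrightarrow> t < b \<Longrightarrow> cross3 (d1 r t) (d2 r t) = (\<rho> t * (\<rho> t * \<sigma> t)) *\<^sub>R cross3 (T t) (N t)"
  by (simp add: d1_eq d2_eq cross_add_right cross_mult_left cross_mult_right)

lemma regular:
  assumes "a < t" "t < b"
  shows "d1 r t \<noteq> 0" "curvature r t \<noteq> 0" "torsion r t \<noteq> 0"
proof -
  note rates = rates_pos[OF assms] and nonzero = frame_nonzero[OF less_imp_le less_imp_le, OF assms]
  show d1: "d1 r t \<noteq> 0" using rates nonzero by (simp add: d1_eq[OF assms])
  have cross: "cross3 (d1 r t) (d2 r t) \<noteq> 0" using rates nonzero by (simp add: cross_d1_d2[OF assms])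
  then show "curvature r t \<noteq> 0" using d1 by (simp add: curvature_def)
  have "cross3 (d1 r t) (d2 r t) \<bullet> d3 r t =
     \<rho> t * (\<rho> t * \<sigma> t) * (\<rho> t * \<sigma> t * \<omega> t) * (cross3 (T t) (N t) \<bullet> B)"
    unfolding cross_d1_d2[OF assms] d3_eq[OF assms] by (simp add: inner_add_right dot_cross_self)
  then show "torsion r t \<noteq> 0" using cross rates nonzero by (simp add: torsion_def)
qed

lemma unit_binormal_eq:
  assumes "a < t" "t < b"
  shows "unit_binormal r t = sgn (cross3 (T t) (N t))"
proof -
  have "unit_binormal r t = sgn (cross3 (d1 r t) (d2 r t))"
    by (simp add: unit_binormal_def sgn_div_norm divide_inverse)
  then show ?thesis using rates_pos[OF assms] by (simp add: cross_d1_d2[OF assms] sgn_scaleR)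
qed

lemma binormal_eq:
  "a \<le> s \<Longrightarrow> s < b \<Longrightarrow> binormal_plus r s = sgn (cross3 (T s) (N s))"
  "a < s \<Longrightarrow> s \<le> b \<Longrightarrow> binormal_minus r s = sgn (cross3 (T s) (N s))"
  unfolding binormal_plus_def binormal_minus_def
  by (rule Lim_at_right_continuous_on[OF continuous_sgn_frame(2)]
      Lim_at_left_continuous_on[OF continuous_sgn_frame(2)]; simp add: unit_binormal_eq)+

lemma osc_eq:
  "a < s \<Longrightarrow> s < b \<Longrightarrow> osc r s = osculating_plane s"
  "a \<le> s \<Longrightarrow> s < b \<Longrightarrow> osc_plus r s = osculating_plane s"
  "a < s \<Longrightarrow> s \<le> b \<Longrightarrow> osc_minus r s = osculating_plane s"
  using frame_nonzero(2)[of s]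
  by (auto simp: osc_def osc_plus_def osc_minus_def unit_binormal_eq binormal_eq osculating_plane_eq
      sgn_div_norm)

lemma assoc_tet_vertices:
  assumes "a \<le> s" "s < t" "t \<le> b"
  shows "assoc_tet r s t (r s) (left_vertex s t) (right_vertex s t) (r t)"
  using tangents_Int_osculating_planes[OF assms] assms
    positive_frame.left_vertex_neq_right_vertex[OF subframe[OF assms]]
  by (simp add: assoc_tet_def tline_eq osc_eq)

lemma osc_Int_edges:
  "\<exists>p01 p12 p23. (\<forall>t. a < t \<and> t < b \<longrightarrow> osc r t \<inter> affine hull {r a, v1} = {p01 t} \<and>
      osc r t \<inter> affine hull {v1, v2} = {p12 t} \<and> osc r t \<inter> affine hull {v2, r b} = {p23 t}) \<and>
    strictly_monotone_on {a<..<b} (\<lambda>t. dist (r a) (p01 t)) \<and>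
    strictly_monotone_on {a<..<b} (\<lambda>t. dist v1 (p12 t)) \<and>
    strictly_monotone_on {a<..<b} (\<lambda>t. dist v2 (p23 t))"
  using osculating_plane_Int_edges by (simp add: osc_eq cong: conj_cong)

lemma quasi_cubic:
  assumes simple: "\<And>s t. a < t \<Longrightarrow> t < b \<Longrightarrow> s \<in> I \<Longrightarrow> s \<noteq> t \<Longrightarrow> r s \<noteq> r t"
  shows "quasi_cubic r I a b"
  unfolding quasi_cubic_def
proof (rule conjI[OF less], rule exI[of _ "r a"], rule exI[of _ v1], rule exI[of _ v2],
    rule exI[of _ "r b"], intro conjI)
  show "assoc_tet r a b (r a) v1 v2 (r b)" using assoc_tet_vertices less by simp
  show "affine hull {r a, v1, v2} = osc_plus r a" "affine hull {v1, v2, r b} = osc_minus r b"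
    using less by (simp_all add: tetra.affine_hull_faces osc_eq osculating_plane_def vol_def)
  show "r ` {a..b} \<subseteq> convex hull {r a, v1, v2, r b}" using curve_mem_tetra by (auto simp: tetra_def)
  show "\<forall>t. a < t \<and> t < b \<longrightarrow> \<not> singular_param r I t \<and> curvature r t \<noteq> 0 \<and> torsion r t \<noteq> 0"
    using regular simple unfolding singular_param_def by blast
  show "\<forall>s t. a \<le> s \<and> s < t \<and> t \<le> b \<longrightarrow> (\<exists>s0 s1 s2 s3. assoc_tet r s t s0 s1 s2 s3 \<and>
      convex hull {s0, s1, s2, s3} \<subseteq> convex hull {r a, v1, v2, r b})"
    using assoc_tet_vertices tetra_subset unfolding tetra_def by blast
qed (fact tetra.not_coplanar parallel_tangents osc_Int_edges planes_through_opposite_edges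
    parallel_farthest_right_face parallel_farthest_left_face)+

end

definition smoothly_framed :: "real \<Rightarrow> real \<Rightarrow> (real \<Rightarrow> real ^ 3) \<Rightarrow> bool" where
  "smoothly_framed a b r \<longleftrightarrow>
    (\<exists>\<kappa> T N B \<rho> \<sigma> \<omega> \<rho>' \<rho>'' \<sigma>'. smooth_positive_frame \<kappa> a b r T N B \<rho> \<sigma> \<omega> \<rho>' \<rho>'' \<sigma>')"

lemma quasi_cubic_if_smoothly_framed:
  assumes "smoothly_framed a b r" "\<And>s t. a < t \<Longrightarrow> t < b \<Longrightarrow> s \<in> I \<Longrightarrow> s \<noteq> t \<Longrightarrow> r s \<noteq> r t"
  shows "quasi_cubic r I a b"
  using assms smooth_positive_frame.quasi_cubic unfolding smoothly_framed_def by blast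

section \<open>Germs of rational functions\<close>

definition positive_germ :: "real \<Rightarrow> nat \<Rightarrow> (real \<Rightarrow> real) \<Rightarrow> bool" where
  "positive_germ c k h \<longleftrightarrow> (\<exists>P Q. 0 < poly P c \<and> 0 < poly Q c \<and>
    h = (\<lambda>t. (t - c) ^ k * (poly P t / poly Q t)))"

lemma eventually_poly_pos:
  fixes P :: "real poly"
  assumes "0 < poly P c"
  shows "\<forall>\<^sub>F t in nhds c. 0 < poly P t"
proof -
  have "(poly P \<longlongrightarrow> poly P c) (nhds c)"
    using poly_isCont[of c P] by (simp add: continuous_at tendsto_nhds_iff)
  then show ?thesis using assms by (rule order_tendstoD)
qed

lemma positive_germ_pos:
  assumes "positive_germ c k h"
  shows "\<forall>\<^sub>F t in nhds c. c < t \<longrightarrow> 0 < h t"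
proof -
  obtain P Q where PQ: "0 < poly P c" "0 < poly Q c"
    and h: "h = (\<lambda>t. (t - c) ^ k * (poly P t / poly Q t))"
    using assms unfolding positive_germ_def by auto
  show ?thesis using eventually_poly_pos[OF PQ(1)] eventually_poly_pos[OF PQ(2)]
    by eventually_elim (simp add: h)
qed

lemma DERIV_rational:
  fixes P Q :: "real poly"
  assumes "poly Q t \<noteq> 0"
  shows "((\<lambda>t. poly P t / poly Q t) has_real_derivative
    poly (pderiv P * Q - P * pderiv Q) t / poly (Q * Q) t) (at t)"
  using assms by (auto intro!: derivative_eq_intros)

lemma positive_germ_deriv:
  assumes "positive_germ c k h" "0 < k"
  obtains h' where "positive_germ c (k - 1) h'"
    "\<forall>\<^sub>F t in nhds c. (h has_real_derivative h' t) (at t)"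
proof -
  obtain P Q where PQ: "0 < poly P c" "0 < poly Q c"
    and h: "h = (\<lambda>t. (t - c) ^ k * (poly P t / poly Q t))"
    using assms(1) unfolding positive_germ_def by auto
  obtain j where k: "k = Suc j" using assms(2) by (cases k) auto
  define P' where "P' = smult (real k) (P * Q) + [:- c, 1:] * (pderiv P * Q - P * pderiv Q)"
  define h' where "h' = (\<lambda>t. (t - c) ^ j * (poly P' t / poly (Q * Q) t))"
  have "(h has_real_derivative h' t) (at t)" if "0 < poly Q t" for t
  proof -
    have "((\<lambda>t. (t - c) ^ k) has_real_derivative real k * (t - c) ^ j) (at t)"
      by (auto intro!: derivative_eq_intros simp: k simp del: power_Suc)
    moreover have "((\<lambda>t. poly P t / poly Q t) has_real_derivative
        poly (pderiv P * Q - P * pderiv Q) t / poly (Q * Q) t) (at t)"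
      using that by (intro DERIV_rational) simp
    ultimately have "(h has_real_derivative real k * (t - c) ^ j * (poly P t / poly Q t) +
        poly (pderiv P * Q - P * pderiv Q) t / poly (Q * Q) t * (t - c) ^ k) (at t)"
      unfolding h by (rule DERIV_mult)
    then show ?thesis
      by (rule DERIV_cong) (use that in \<open>simp add: h'_def P'_def k field_simps\<close>)
  qed
  then have "\<forall>\<^sub>F t in nhds c. (h has_real_derivative h' t) (at t)"
    using eventually_poly_pos[OF PQ(2)] by (auto elim: eventually_mono)
  moreover have "0 < poly P' c" using PQ assms(2) by (simp add: P'_def)
  then have "positive_germ c (k - 1) h'"
    using PQ unfolding positive_germ_def h'_def k by (intro exI[of _ P'] exI[of _ "Q * Q"]) simp
  ultimately show ?thesis using that by blast
qed

lemma positive_germ_twice_differentiable: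
  assumes "positive_germ c k h"
  obtains h' h'' where "\<forall>\<^sub>F t in nhds c. (h has_real_derivative h' t) (at t)"
    "\<forall>\<^sub>F t in nhds c. (h' has_real_derivative h'' t) (at t)"
proof -
  obtain P Q where PQ: "0 < poly P c" "0 < poly Q c"
    and "h = (\<lambda>t. (t - c) ^ k * (poly P t / poly Q t))"
    using assms unfolding positive_germ_def by auto
  then have h: "h = (\<lambda>t. poly ([:- c, 1:] ^ k * P) t / poly Q t)" by auto
  show ?thesis
    by (rule that; rule eventually_mono[OF eventually_poly_pos[OF PQ(2)]]; (unfold h)?;
        rule DERIV_rational) simp_all
qed

lemma positive_germ_quotient:
  assumes "positive_germ c k h" "positive_germ c j h2" "j \<le> k"
  obtains q where "positive_germ c (k - j) q" "\<forall>\<^sub>F t in nhds c. h t = q t * h2 t"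
proof -
  obtain P Q where PQ: "0 < poly P c" "0 < poly Q c"
    and h: "h = (\<lambda>t. (t - c) ^ k * (poly P t / poly Q t))"
    using assms(1) unfolding positive_germ_def by auto
  obtain P2 Q2 where PQ2: "0 < poly P2 c" "0 < poly Q2 c"
    and h2: "h2 = (\<lambda>t. (t - c) ^ j * (poly P2 t / poly Q2 t))"
    using assms(2) unfolding positive_germ_def by auto
  define q where "q = (\<lambda>t. (t - c) ^ (k - j) * (poly (P * Q2) t / poly (Q * P2) t))"
  have "positive_germ c (k - j) q"
    using PQ PQ2 unfolding positive_germ_def q_def by (intro exI[of _ "P * Q2"] exI[of _ "Q * P2"]) simp
  moreover have "\<forall>\<^sub>F t in nhds c. h t = q t * h2 t"
    using eventually_poly_pos[OF PQ(2)] eventually_poly_pos[OF PQ2(1)] eventually_poly_pos[OF PQ2(2)]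
  proof eventually_elim
    case (elim t)
    have "(t - c) ^ k = (t - c) ^ (k - j) * (t - c) ^ j" using assms(3) by (simp flip: power_add)
    then show ?case using elim by (simp add: h h2 q_def)
  qed
  ultimately show ?thesis using that by blast
qed

lemma positive_germ_deriv_quotient:
  assumes "positive_germ c k h" "positive_germ c j h2" "0 < k" "j \<le> k - 1"
  obtains q where "positive_germ c (k - 1 - j) q"
    "\<forall>\<^sub>F t in nhds c. (h has_real_derivative q t * h2 t) (at t)"
proof -
  obtain h' where h': "positive_germ c (k - 1) h'" "\<forall>\<^sub>F t in nhds c. (h has_real_derivative h' t) (at t)"
    using positive_germ_deriv assms(1,3) by blast
  obtain q where q: "positive_germ c (k - 1 - j) q" "\<forall>\<^sub>F t in nhds c. h' t = q t * h2 t"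
    using positive_germ_quotient h'(1) assms(2,4) by blast
  from h'(2) q(2) have "\<forall>\<^sub>F t in nhds c. (h has_real_derivative q t * h2 t) (at t)"
    by eventually_elim simp
  with q(1) show ?thesis using that by blast
qed

lemma positive_germ_rates:
  assumes x: "positive_germ c k1 x" and f: "positive_germ c k2 f" and g: "positive_germ c k3 g"
    and order: "0 < k1" "k1 < k2" "k2 < k3"
  obtains \<rho> \<sigma> \<omega> y p w i j k where
    "positive_germ c i \<rho>" "positive_germ c j \<sigma>" "positive_germ c k \<omega>"
    "\<forall>\<^sub>F t in nhds c. (x has_real_derivative \<rho> t) (at t)"
    "\<forall>\<^sub>F t in nhds c. (f has_real_derivative y t * \<rho> t) (at t)"
    "\<forall>\<^sub>F t in nhds c. (g has_real_derivative p t * \<rho> t) (at t)"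
    "\<forall>\<^sub>F t in nhds c. (y has_real_derivative \<sigma> t) (at t)"
    "\<forall>\<^sub>F t in nhds c. (p has_real_derivative w t * \<sigma> t) (at t)"
    "\<forall>\<^sub>F t in nhds c. (w has_real_derivative \<omega> t) (at t)"
proof -
  obtain \<rho> where \<rho>: "positive_germ c (k1 - 1) \<rho>" "\<forall>\<^sub>F t in nhds c. (x has_real_derivative \<rho> t) (at t)"
    using positive_germ_deriv[OF x] order by auto
  obtain y where y: "positive_germ c (k2 - 1 - (k1 - 1)) y"
    "\<forall>\<^sub>F t in nhds c. (f has_real_derivative y t * \<rho> t) (at t)"
    by (rule positive_germ_deriv_quotient[OF f \<rho>(1)]) (use order in auto)
  obtain p where p: "positive_germ c (k3 - 1 - (k1 - 1)) p"
    "\<forall>\<^sub>F t in nhds c. (g has_real_derivative p t * \<rho> t) (at t)"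
    by (rule positive_germ_deriv_quotient[OF g \<rho>(1)]) (use order in auto)
  obtain \<sigma> where \<sigma>: "positive_germ c (k2 - 1 - (k1 - 1) - 1) \<sigma>"
    "\<forall>\<^sub>F t in nhds c. (y has_real_derivative \<sigma> t) (at t)"
    by (rule positive_germ_deriv[OF y(1)]) (use order in auto)
  obtain w where w: "positive_germ c (k3 - 1 - (k1 - 1) - 1 - (k2 - 1 - (k1 - 1) - 1)) w"
    "\<forall>\<^sub>F t in nhds c. (p has_real_derivative w t * \<sigma> t) (at t)"
    by (rule positive_germ_deriv_quotient[OF p(1) \<sigma>(1)]) (use order in auto)
  obtain \<omega> where \<omega>: "positive_germ c (k3 - 1 - (k1 - 1) - 1 - (k2 - 1 - (k1 - 1) - 1) - 1) \<omega>"
    "\<forall>\<^sub>F t in nhds c. (w has_real_derivative \<omega> t) (at t)"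
    by (rule positive_germ_deriv[OF w(1)]) (use order in auto)
  show ?thesis by (rule that[OF \<rho>(1) \<sigma>(1) \<omega>(1) \<rho>(2) y(2) p(2) \<sigma>(2) w(2) \<omega>(2)])
qed

lemma eventually_smooth_positive_frame:
  assumes unimodular: "\<And>t. volume_form.vol \<kappa> (T t) (N t) B = 1"
    and frenet: "\<forall>\<^sub>F t in nhds c. (r has_vector_derivative \<rho> t *\<^sub>R T t) (at t)"
      "\<forall>\<^sub>F t in nhds c. (T has_vector_derivative \<sigma> t *\<^sub>R N t) (at t)"
      "\<forall>\<^sub>F t in nhds c. (N has_vector_derivative \<omega> t *\<^sub>R B) (at t)"
    and pos: "\<forall>\<^sub>F t in nhds c. c < t \<longrightarrow> 0 < \<rho> t" "\<forall>\<^sub>F t in nhds c. c < t \<longrightarrow> 0 < \<sigma> t"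
      "\<forall>\<^sub>F t in nhds c. c < t \<longrightarrow> 0 < \<omega> t"
    and deriv: "\<forall>\<^sub>F t in nhds c. (\<rho> has_real_derivative \<rho>' t) (at t)"
      "\<forall>\<^sub>F t in nhds c. (\<rho>' has_real_derivative \<rho>'' t) (at t)"
      "\<forall>\<^sub>F t in nhds c. (\<sigma> has_real_derivative \<sigma>' t) (at t)"
  shows "\<forall>\<^sub>F b in at_right c. smooth_positive_frame \<kappa> c b r T N B \<rho> \<sigma> \<omega> \<rho>' \<rho>'' \<sigma>'"
proof -
  let ?good = "\<lambda>t. (r has_vector_derivative \<rho> t *\<^sub>R T t) (at t) \<and>
    (T has_vector_derivative \<sigma> t *\<^sub>R N t) (at t) \<and>
    (N has_vector_derivative \<omega> t *\<^sub>R B) (at t) \<and> (c < t \<longrightarrow> 0 < \<rho> t \<and> 0 < \<sigma> t \<and> 0 < \<omega> t) \<and>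
    (\<rho> has_real_derivative \<rho>' t) (at t) \<and> (\<rho>' has_real_derivative \<rho>'' t) (at t) \<and>
    (\<sigma> has_real_derivative \<sigma>' t) (at t)"
  have "eventually ?good (nhds c)"
    using frenet pos deriv by eventually_elim auto
  then obtain \<delta> where "0 < \<delta>" and good: "\<And>t. dist t c < \<delta> \<Longrightarrow> ?good t"
    unfolding eventually_nhds_metric by blast
  have "smooth_positive_frame \<kappa> c b r T N B \<rho> \<sigma> \<omega> \<rho>' \<rho>'' \<sigma>'" if "c < b" "b < c + \<delta>" for b
  proof unfold_locales
    have "isCont r t \<and> isCont T t \<and> isCont N t" if "c \<le> t" "t \<le> b" for t
    proof -
      have "?good t" using that \<open>b < c + \<delta>\<close> by (intro good) (simp add: dist_real_def)
      then show ?thesis by (blast intro: has_vector_derivative_continuous)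
    qed
    then show "continuous_on {c..b} r" "continuous_on {c..b} T" "continuous_on {c..b} N"
      by (auto intro!: continuous_at_imp_continuous_on)
  qed (use good that unimodular in \<open>auto simp: dist_real_def\<close>)
  then show ?thesis using \<open>0 < \<delta>\<close> unfolding eventually_at_right_field by (intro exI[of _ "c + \<delta>"]) auto
qed

lemma eventually_smoothly_framed:
  fixes e1 e2 e3 :: "real ^ 3"
  assumes germs: "positive_germ c k1 x" "positive_germ c k2 f" "positive_germ c k3 g"
    and order: "0 < k1" "k1 < k2" "k2 < k3" and det: "cross3 e1 e2 \<bullet> e3 \<noteq> 0"
    and r: "\<forall>\<^sub>F t in nhds c. r t = r c + x t *\<^sub>R e1 + f t *\<^sub>R e2 + g t *\<^sub>R e3"
  shows "\<forall>\<^sub>F b in at_right c. smoothly_framed c b r"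
proof -
  obtain \<rho> \<sigma> \<omega> y p w i j k where rates: "positive_germ c i \<rho>" "positive_germ c j \<sigma>" "positive_germ c k \<omega>"
    and x: "\<forall>\<^sub>F t in nhds c. (x has_real_derivative \<rho> t) (at t)"
    and f: "\<forall>\<^sub>F t in nhds c. (f has_real_derivative y t * \<rho> t) (at t)"
    and g: "\<forall>\<^sub>F t in nhds c. (g has_real_derivative p t * \<rho> t) (at t)"
    and y: "\<forall>\<^sub>F t in nhds c. (y has_real_derivative \<sigma> t) (at t)"
    and p: "\<forall>\<^sub>F t in nhds c. (p has_real_derivative w t * \<sigma> t) (at t)"
    and w: "\<forall>\<^sub>F t in nhds c. (w has_real_derivative \<omega> t) (at t)"
    using positive_germ_rates[OF germs order] .
  obtain \<rho>' \<rho>'' where \<rho>': "\<forall>\<^sub>F t in nhds c. (\<rho> has_real_derivative \<rho>' t) (at t)"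
    "\<forall>\<^sub>F t in nhds c. (\<rho>' has_real_derivative \<rho>'' t) (at t)"
    using positive_germ_twice_differentiable[OF rates(1)] .
  obtain \<sigma>' \<sigma>'' where \<sigma>': "\<forall>\<^sub>F t in nhds c. (\<sigma> has_real_derivative \<sigma>' t) (at t)"
    "\<forall>\<^sub>F t in nhds c. (\<sigma>' has_real_derivative \<sigma>'' t) (at t)"
    using positive_germ_twice_differentiable[OF rates(2)] .
  define T where "T t = e1 + y t *\<^sub>R e2 + p t *\<^sub>R e3" for t
  define N where "N t = e2 + w t *\<^sub>R e3" for t
  have "\<forall>\<^sub>F t in nhds c. (r has_vector_derivative \<rho> t *\<^sub>R T t) (at t)"
    using eventually_eventually[THEN iffD2, OF r] x f g
  proof eventually_elim
    case (elim t)
    have "((\<lambda>t. r c + x t *\<^sub>R e1 + f t *\<^sub>R e2 + g t *\<^sub>R e3) has_vector_derivative \<rho> t *\<^sub>R T t) (at t)"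
      unfolding T_def using elim by (auto intro!: derivative_eq_intros simp: algebra_simps)
    moreover have "r t = r c + x t *\<^sub>R e1 + f t *\<^sub>R e2 + g t *\<^sub>R e3"
      using elim(1) by (rule eventually_nhds_x_imp_x)
    ultimately show ?case using elim(1) by (subst has_vector_derivative_cong_ev) auto
  qed
  moreover have "\<forall>\<^sub>F t in nhds c. (T has_vector_derivative \<sigma> t *\<^sub>R N t) (at t)"
    using y p by eventually_elim
      (auto simp: T_def[abs_def] N_def algebra_simps intro!: derivative_eq_intros)
  moreover have "\<forall>\<^sub>F t in nhds c. (N has_vector_derivative \<omega> t *\<^sub>R e3) (at t)"
    using w by eventually_elim (auto simp: N_def[abs_def] intro!: derivative_eq_intros)
  moreover have "volume_form.vol (1 / (cross3 e1 e2 \<bullet> e3)) (T t) (N t) e3 = 1" for t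
    using det by (simp add: volume_form.vol_def volume_form.normal_def T_def N_def cross_add_left
        cross_add_right cross_mult_left cross_mult_right inner_add_left dot_cross_self)
  ultimately have "\<forall>\<^sub>F b in at_right c.
      smooth_positive_frame (1 / (cross3 e1 e2 \<bullet> e3)) c b r T N e3 \<rho> \<sigma> \<omega> \<rho>' \<rho>'' \<sigma>'"
    by (intro eventually_smooth_positive_frame rates[THEN positive_germ_pos] \<rho>' \<sigma>')
  then show ?thesis unfolding smoothly_framed_def by eventually_elim blast
qed

section \<open>Rational curves\<close>

lemma order_cancel:
  fixes P Q :: "real poly"
  assumes "P \<noteq> 0" "Q \<noteq> 0" "order c P = order c Q"
  obtains k where "P - smult k Q = 0 \<or> order c (P - smult k Q) > order c P"
proof -
  let ?n = "order c P"
  obtain P' where P': "P = [:- c, 1:] ^ ?n * P'" using order_decomp[OF assms(1)] by blast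
  obtain Q' where Q': "Q = [:- c, 1:] ^ ?n * Q'" "\<not> [:- c, 1:] dvd Q'"
    using order_decomp[OF assms(2), of c] assms(3) by auto
  define k where "k = poly P' c / poly Q' c"
  have "poly Q' c \<noteq> 0" using Q'(2) by (simp add: poly_eq_0_iff_dvd)
  then have "poly (P' - smult k Q') c = 0" by (simp add: k_def)
  then have "[:- c, 1:] dvd P' - smult k Q'" unfolding poly_eq_0_iff_dvd .
  then have "[:- c, 1:] ^ ?n * [:- c, 1:] dvd [:- c, 1:] ^ ?n * (P' - smult k Q')"
    by (rule mult_dvd_mono[OF dvd_refl])
  also have "[:- c, 1:] ^ ?n * (P' - smult k Q') = P - smult k Q"
    by (subst (2) P', subst Q') (simp add: algebra_simps)
  finally have "[:- c, 1:] ^ Suc ?n dvd P - smult k Q" by (simp add: mult.commute)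
  then show ?thesis using that[of k] unfolding order_divides by auto
qed

text \<open>In a basis with the largest total order all orders differ, since cancelling leading terms would
  raise one of two equal orders.\<close>

lemma basis_with_increasing_orders:
  fixes h :: "real ^ 3 \<Rightarrow> real poly"
  assumes linear: "\<And>n m k. h (n - k *\<^sub>R m) = h n - smult k (h m)"
    and nonzero: "\<And>n. n \<noteq> 0 \<Longrightarrow> h n \<noteq> 0" and bound: "\<And>n. n \<noteq> 0 \<Longrightarrow> order c (h n) \<le> K"
  obtains m1 m2 m3 where "cross3 m1 m2 \<bullet> m3 \<noteq> 0"
    "order c (h m1) < order c (h m2)" "order c (h m2) < order c (h m3)"
proof -
  let ?ord = "\<lambda>n. order c (h n)" and ?basis = "\<lambda>u v w. cross3 u v \<bullet> w \<noteq> (0 :: real)"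
  let ?total = "\<lambda>k. \<exists>u v w. ?basis u v w \<and> ?ord u + ?ord v + ?ord w = k"
  have basis_nonzero: "u \<noteq> 0" "v \<noteq> 0" "w \<noteq> 0" if "?basis u v w" for u v w using that by auto
  have "?basis (axis 1 1) (axis 2 1) (axis 3 1)" by (simp add: cross_basis inner_axis_axis)
  then have "?total (?ord (axis 1 1) + ?ord (axis 2 1) + ?ord (axis 3 1))" by blast
  moreover have "\<forall>k. ?total k \<longrightarrow> k \<le> 3 * K"
  proof (intro allI impI)
    fix k assume "?total k"
    then obtain u v w where "?basis u v w" "?ord u + ?ord v + ?ord w = k" by blast
    then show "k \<le> 3 * K" using bound[of u] bound[of v] bound[of w] basis_nonzero[of u v w] by linarith
  qed
  ultimately obtain k where k: "?total k" "\<And>j. ?total j \<Longrightarrow> j \<le> k"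
    using Nat.ex_has_greatest_nat[of ?total] by blast
  have distinct: "?ord u \<noteq> ?ord v" if uvw: "?basis u v w" "?ord u + ?ord v + ?ord w = k" for u v w
  proof
    assume "?ord u = ?ord v"
    then obtain l where l: "h (u - l *\<^sub>R v) = 0 \<or> ?ord u < ?ord (u - l *\<^sub>R v)"
      using order_cancel nonzero basis_nonzero[OF uvw(1)] unfolding linear by metis
    have "?basis (u - l *\<^sub>R v) v w" using uvw(1) by (simp add: Cross3.left_diff_distrib cross_mult_left)
    then have "?ord (u - l *\<^sub>R v) + ?ord v + ?ord w \<le> k" "h (u - l *\<^sub>R v) \<noteq> 0"
      using k(2) nonzero basis_nonzero(1) by blast+
    then show False using l uvw(2) by simp
  qed
  obtain u v w where uvw: "?basis u v w" "?ord u + ?ord v + ?ord w = k" using k(1) by blast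
  have rotate: "?basis y z x" if "?basis x y z" for x y z using that cross_triple[of x y z] by simp
  have swap: "?basis y x z" if "?basis x y z" for x y z using that cross_skew[of y x] by simp
  have "?ord u \<noteq> ?ord v" "?ord v \<noteq> ?ord w" "?ord w \<noteq> ?ord u"
    using distinct[of u v w] distinct[of v w u] distinct[of w u v] rotate uvw by (auto simp: ac_simps)
  then consider "?ord u < ?ord v" "?ord v < ?ord w" | "?ord u < ?ord w" "?ord w < ?ord v"
    | "?ord v < ?ord u" "?ord u < ?ord w" | "?ord v < ?ord w" "?ord w < ?ord u"
    | "?ord w < ?ord u" "?ord u < ?ord v" | "?ord w < ?ord v" "?ord v < ?ord u" by linarith
  then show ?thesis by cases (use that uvw(1) rotate swap in blast)+
qed

definition common_denominator :: "real poly ^ 3 \<Rightarrow> real poly" where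
  "common_denominator q = (\<Prod>i\<in>UNIV. q $ i)"

definition chord_numerator :: "real poly ^ 3 \<Rightarrow> real poly ^ 3 \<Rightarrow> real \<Rightarrow> 3 \<Rightarrow> real poly" where
  "chord_numerator p q c i = (p $ i - smult (rat_curve p q c $ i) (q $ i)) * (\<Prod>j\<in>UNIV - {i}. q $ j)"

definition height_numerator :: "real poly ^ 3 \<Rightarrow> real poly ^ 3 \<Rightarrow> real \<Rightarrow> real ^ 3 \<Rightarrow> real poly" where
  "height_numerator p q c n = (\<Sum>i\<in>UNIV. smult (n $ i) (chord_numerator p q c i))"

lemma poly_common_denominator_eq_0_iff: "poly (common_denominator q) t = 0 \<longleftrightarrow> (\<exists>i. poly (q $ i) t = 0)"
  by (simp add: common_denominator_def poly_prod)

lemma eventually_denominators_nonzero: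
  fixes q :: "real poly ^ 3"
  assumes "\<forall>i. poly (q $ i) c \<noteq> 0"
  shows "\<forall>\<^sub>F t in nhds c. \<forall>i. poly (q $ i) t \<noteq> 0"
proof -
  have "0 < poly (common_denominator q * common_denominator q) c"
    using assms by (metis not_real_square_gt_zero poly_mult poly_common_denominator_eq_0_iff)
  from eventually_poly_pos[OF this] show ?thesis
    by eventually_elim (metis less_irrefl mult_zero_left poly_mult poly_common_denominator_eq_0_iff)
qed

lemma chord_numerator_eval:
  assumes "\<forall>i. poly (q $ i) t \<noteq> 0"
  shows "poly (chord_numerator p q c i) t / poly (common_denominator q) t =
    (rat_curve p q t - rat_curve p q c) $ i"
proof -
  have "common_denominator q = q $ i * (\<Prod>j\<in>UNIV - {i}. q $ j)"
    unfolding common_denominator_def by (rule prod.remove) auto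
  moreover have "poly (\<Prod>j\<in>UNIV - {i}. q $ j) t \<noteq> 0" using assms by (simp add: poly_prod)
  ultimately show ?thesis using assms by (simp add: chord_numerator_def rat_curve_def field_simps)
qed

lemma height_numerator_eval:
  assumes "\<forall>i. poly (q $ i) t \<noteq> 0"
  shows "poly (height_numerator p q c n) t / poly (common_denominator q) t =
    n \<bullet> (rat_curve p q t - rat_curve p q c)"
  by (simp add: height_numerator_def poly_sum sum_divide_distrib inner_vec_def
      chord_numerator_eval[OF assms] flip: times_divide_eq_right)

lemma height_numerator_linear:
  "height_numerator p q c (n - k *\<^sub>R m) = height_numerator p q c n - smult k (height_numerator p q c m)"
  by (rule poly_eqI)
    (simp add: height_numerator_def coeff_sum sum_subtractf[symmetric] sum_distrib_left
      left_diff_distrib mult.assoc)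

lemma height_numerator_nonzero:
  assumes "\<forall>i. \<forall>t\<in>I. poly (q $ i) t \<noteq> 0" "non_planar (rat_curve p q) I" "n \<noteq> 0"
  shows "height_numerator p q c n \<noteq> 0"
proof
  assume "height_numerator p q c n = 0"
  then have "n \<bullet> rat_curve p q t = n \<bullet> rat_curve p q c" if "t \<in> I" for t
    using height_numerator_eval[of q t p c n] assms(1) that by (simp add: inner_diff_right)
  then show False using assms(2,3) unfolding non_planar_def by blast
qed

lemma order_height_numerator_le:
  assumes "height_numerator p q c n \<noteq> 0"
  shows "order c (height_numerator p q c n) \<le> (\<Sum>i\<in>UNIV. degree (chord_numerator p q c i))"
proof -
  have "degree (height_numerator p q c n) \<le> (\<Sum>i\<in>UNIV. degree (chord_numerator p q c i))"
    unfolding height_numerator_def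
    by (intro degree_sum_le order_trans[OF degree_smult_le] member_le_sum) auto
  then show ?thesis using order_degree[OF assms, of c] by (rule order_trans[rotated])
qed

lemma height_positive_germ:
  assumes q: "\<forall>i. poly (q $ i) c \<noteq> 0" and nonzero: "height_numerator p q c n \<noteq> 0"
  obtains s x where "s \<noteq> 0" "positive_germ c (order c (height_numerator p q c n)) x"
    "\<forall>\<^sub>F t in nhds c. x t = (s *\<^sub>R n) \<bullet> (rat_curve p q t - rat_curve p q c)"
proof -
  let ?h = "height_numerator p q c n" and ?q = "common_denominator q"
  let ?k = "order c ?h"
  obtain P where P: "?h = [:- c, 1:] ^ ?k * P" "\<not> [:- c, 1:] dvd P" using order_decomp[OF nonzero] by blast
  define s where "s = poly P c * poly ?q c"
  have "poly P c \<noteq> 0" using P(2) by (simp add: poly_eq_0_iff_dvd)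
  then have s: "s \<noteq> 0" using q by (simp add: s_def poly_common_denominator_eq_0_iff)
  define x where "x = (\<lambda>t. (t - c) ^ ?k * (poly (smult s (P * ?q)) t / poly (?q * ?q) t))"
  have "0 < poly (smult s (P * ?q)) c"
    using s not_real_square_gt_zero[of s] by (simp add: s_def mult.assoc)
  moreover have "0 < poly (?q * ?q) c"
    using q by (metis not_real_square_gt_zero poly_mult poly_common_denominator_eq_0_iff)
  ultimately have "positive_germ c ?k x" unfolding positive_germ_def x_def by blast
  moreover have "\<forall>\<^sub>F t in nhds c. x t = (s *\<^sub>R n) \<bullet> (rat_curve p q t - rat_curve p q c)"
    using eventually_denominators_nonzero[OF q]
  proof eventually_elim
    case (elim t)
    have "poly ?h t = (t - c) ^ ?k * poly P t" by (subst P(1)) simp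
    then have "x t = s * (poly ?h t / poly ?q t)"
      using elim by (simp add: x_def poly_common_denominator_eq_0_iff)
    then show ?case using height_numerator_eval[OF elim] by simp
  qed
  ultimately show ?thesis using that s by blast
qed

lemma rat_curve_adapted_heights:
  assumes q: "\<forall>i. poly (q $ i) c \<noteq> 0" and nonzero: "\<And>n. n \<noteq> 0 \<Longrightarrow> height_numerator p q c n \<noteq> 0"
  obtains m1 m2 m3 k1 k2 k3 x f g where "cross3 m1 m2 \<bullet> m3 \<noteq> 0" "0 < k1" "k1 < k2" "k2 < k3"
    "positive_germ c k1 x" "positive_germ c k2 f" "positive_germ c k3 g"
    "\<forall>\<^sub>F t in nhds c. x t = m1 \<bullet> (rat_curve p q t - rat_curve p q c)"
    "\<forall>\<^sub>F t in nhds c. f t = m2 \<bullet> (rat_curve p q t - rat_curve p q c)"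
    "\<forall>\<^sub>F t in nhds c. g t = m3 \<bullet> (rat_curve p q t - rat_curve p q c)"
proof -
  let ?r = "rat_curve p q" and ?h = "height_numerator p q c"
  obtain m1 m2 m3 where basis: "cross3 m1 m2 \<bullet> m3 \<noteq> 0"
    "order c (?h m1) < order c (?h m2)" "order c (?h m2) < order c (?h m3)"
    using basis_with_increasing_orders[of ?h, OF height_numerator_linear nonzero
        order_height_numerator_le[OF nonzero]] by blast
  then have m_nonzero: "?h m1 \<noteq> 0" "?h m2 \<noteq> 0" "?h m3 \<noteq> 0" by (auto intro!: nonzero)
  have "poly (?h m1) c = 0"
    using height_numerator_eval[OF q, of p c m1] q by (simp add: poly_common_denominator_eq_0_iff)
  then have order_pos: "0 < order c (?h m1)" using m_nonzero by (simp add: order_root)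
  obtain s1 x where x_germ: "s1 \<noteq> 0" "positive_germ c (order c (?h m1)) x"
    "\<forall>\<^sub>F t in nhds c. x t = (s1 *\<^sub>R m1) \<bullet> (?r t - ?r c)"
    using height_positive_germ[OF q m_nonzero(1)] by blast
  obtain s2 f where f_germ: "s2 \<noteq> 0" "positive_germ c (order c (?h m2)) f"
    "\<forall>\<^sub>F t in nhds c. f t = (s2 *\<^sub>R m2) \<bullet> (?r t - ?r c)"
    using height_positive_germ[OF q m_nonzero(2)] by blast
  obtain s3 g where g_germ: "s3 \<noteq> 0" "positive_germ c (order c (?h m3)) g"
    "\<forall>\<^sub>F t in nhds c. g t = (s3 *\<^sub>R m3) \<bullet> (?r t - ?r c)"
    using height_positive_germ[OF q m_nonzero(3)] by blast
  have "cross3 (s1 *\<^sub>R m1) (s2 *\<^sub>R m2) \<bullet> (s3 *\<^sub>R m3) \<noteq> 0"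
    using basis(1) x_germ(1) f_germ(1) g_germ(1) by (simp add: cross_mult_left cross_mult_right)
  then show ?thesis
    by (rule that[OF _ order_pos basis(2,3) x_germ(2) f_germ(2) g_germ(2)
        x_germ(3) f_germ(3) g_germ(3)])
qed

lemma eventually_smoothly_framed_rat_curve:
  assumes "\<forall>i. \<forall>t\<in>I. poly (q $ i) t \<noteq> 0" "non_planar (rat_curve p q) I" "c \<in> I"
  shows "\<forall>\<^sub>F b in at_right c. smoothly_framed c b (rat_curve p q)"
proof -
  let ?r = "rat_curve p q"
  have q: "\<forall>i. poly (q $ i) c \<noteq> 0" using assms(1,3) by blast
  obtain m1 m2 m3 k1 k2 k3 x f g where basis: "cross3 m1 m2 \<bullet> m3 \<noteq> 0"
    and order: "0 < k1" "k1 < k2" "k2 < k3"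
    and germs: "positive_germ c k1 x" "positive_germ c k2 f" "positive_germ c k3 g"
    and heights: "\<forall>\<^sub>F t in nhds c. x t = m1 \<bullet> (?r t - ?r c)"
      "\<forall>\<^sub>F t in nhds c. f t = m2 \<bullet> (?r t - ?r c)"
      "\<forall>\<^sub>F t in nhds c. g t = m3 \<bullet> (?r t - ?r c)"
    using rat_curve_adapted_heights[OF q height_numerator_nonzero[OF assms(1,2)]] .
  obtain e1 e2 e3 where det: "cross3 e1 e2 \<bullet> e3 \<noteq> 0"
    and expansion: "\<And>v. v = (m1 \<bullet> v) *\<^sub>R e1 + (m2 \<bullet> v) *\<^sub>R e2 + (m3 \<bullet> v) *\<^sub>R e3"
    using dual_basis[OF basis] by blast
  have "\<forall>\<^sub>F t in nhds c. ?r t = ?r c + x t *\<^sub>R e1 + f t *\<^sub>R e2 + g t *\<^sub>R e3"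
    using heights
  proof eventually_elim
    case (elim t)
    have "?r t - ?r c = x t *\<^sub>R e1 + f t *\<^sub>R e2 + g t *\<^sub>R e3"
      using expansion[of "?r t - ?r c"] unfolding elim .
    then show ?case by (simp add: algebra_simps)
  qed
  then show ?thesis by (rule eventually_smoothly_framed[OF germs order det])
qed

lemma poly_map_poly_complex_of_real:
  "poly (map_poly complex_of_real p) (complex_of_real t) = complex_of_real (poly p t)"
  by (induction p) (auto simp: map_poly_pCons)

lemma rat_curve_c_of_real: "rat_curve_c p q (complex_of_real t) i = complex_of_real (rat_curve p q t $ i)"
  by (simp add: rat_curve_c_def rat_curve_def poly_map_poly_complex_of_real)

lemma proper_param_eventually_simple:
  assumes "proper_param p q" "\<forall>i. \<forall>t\<in>I. poly (q $ i) t \<noteq> 0"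
  shows "\<forall>\<^sub>F t in at c. t \<in> I \<longrightarrow> (\<forall>s\<in>I. s \<noteq> t \<longrightarrow> rat_curve p q s \<noteq> rat_curve p q t)"
proof -
  let ?double = "{z. defined_at_c q z \<and>
    (\<exists>w. w \<noteq> z \<and> defined_at_c q w \<and> rat_curve_c p q w = rat_curve_c p q z)}"
  have "finite (complex_of_real -` ?double)"
    using assms(1) unfolding proper_param_def by (rule finite_vimageI) (simp add: inj_def)
  then have "\<forall>\<^sub>F t in at c. complex_of_real t \<notin> ?double"
    using islimpt_finite[of "complex_of_real -` ?double" c] by (simp add: islimpt_iff_eventually)
  then show ?thesis
  proof eventually_elim
    case (elim t)
    have defined: "defined_at_c q (complex_of_real s)" if "s \<in> I" for s
      using that assms(2) by (simp add: defined_at_c_def poly_map_poly_complex_of_real)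
    show ?case
    proof (intro impI ballI notI)
      fix s assume s: "t \<in> I" "s \<in> I" "s \<noteq> t" "rat_curve p q s = rat_curve p q t"
      then have "rat_curve_c p q (complex_of_real s) = rat_curve_c p q (complex_of_real t)"
        by (auto simp: rat_curve_c_of_real)
      then show False using elim defined[OF s(1)] defined[OF s(2)] s(3) by auto
    qed
  qed
qed

theorem theorem1:
  fixes p q :: "real poly ^ 3" and I :: "real set" and t0 :: real
  assumes "is_interval I"
    and "\<forall>i. \<forall>t\<in>I. poly (q $ i) t \<noteq> 0"
    and "proper_param p q"
    and "non_planar (rat_curve p q) I"
    and "t0 \<in> I" and "\<exists>t\<in>I. t0 < t"
  shows "\<exists>t1\<in>I. t0 < t1 \<and> quasi_cubic (rat_curve p q) I t0 t1"
proof -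
  let ?simple = "\<lambda>t. \<forall>s\<in>I. s \<noteq> t \<longrightarrow> rat_curve p q s \<noteq> rat_curve p q t"
  obtain \<tau> where \<tau>: "\<tau> \<in> I" "t0 < \<tau>" using assms(6) by blast
  then have mem_I: "t \<in> I" if "t0 < t" "t < \<tau>" for t
    using assms(1,5) that unfolding is_interval_1 by (meson less_imp_le)
  have "\<forall>\<^sub>F t in at_right t0. t \<in> I \<longrightarrow> ?simple t"
    using proper_param_eventually_simple[OF assms(3,2)] by (rule filter_leD[OF at_le, rotated]) simp
  then obtain u where u: "t0 < u" "\<And>t. t0 < t \<Longrightarrow> t < u \<Longrightarrow> t \<in> I \<Longrightarrow> ?simple t"
    unfolding eventually_at_right_field by blast
  have "\<forall>\<^sub>F t1 in at_right t0. smoothly_framed t0 t1 (rat_curve p q) \<and> t1 \<in> {t0<..<min \<tau> u}"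
    using eventually_smoothly_framed_rat_curve[OF assms(2,4,5)] \<tau>(2) u(1)
    by (intro eventually_conj eventually_at_right_real) auto
  then obtain t1 where t1: "smoothly_framed t0 t1 (rat_curve p q)" "t0 < t1" "t1 < \<tau>" "t1 < u"
    using eventually_happens'[OF trivial_limit_at_right_real] by force
  then have "quasi_cubic (rat_curve p q) I t0 t1"
    using u(2) mem_I by (intro quasi_cubic_if_smoothly_framed) auto
  then show ?thesis using t1 mem_I by blast
qed

end
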